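(* Let $\mathfrak{A}$ be a unital complex Jordan--Banach algebra, and let $f\colon\mathfrak{A}\to\mathbb{C}$ be a (not necessarily linear) functional satisfying: (a) $f(U_x(y))=U_{f(x)}f(y)$, i.e. $f(U_x(y))=f(x)^2f(y)$, for all $x,y\in\mathfrak{A}$; (b) $f(x)\in\text{J-}\sigma(x)$ for all $x\in\mathfrak{A}$. Then there exists a unique continuous (Jordan-)multiplicative linear functional $\psi\colon\mathfrak{A}\to\mathbb{C}$ such that $f(x)=\psi(x)$ for every $x$ in the connected component, containing the unit element, of the set of all invertible elements of $\mathfrak{A}$.
   Context: A complex Jordan--Banach algebra is a complex Banach space $\mathfrak{A}$ with a bilinear product $(a,b)\mapsto a\circ b$ satisfying $\|a\circ b\|\le\|a\|\,\|b\|$, $a\circ b=b\circ a$, and $(a^2\circ b)\circ a=(a\circ b)\circ a^2$ for all $a,b$ (where $a^2=a\circ a$). It is unital if there is $\mathbf{1}\in\mathfrak{A}$ with $\mathbf{1}\circ a=a$ for all $a$. For $a\in\mathfrak{A}$, $U_a\colon\mathfrak{A}\to\mathfrak{A}$ is the linear map $U_a(b)=2(a\circ b)\circ a-a^2\circ b$; in $\mathbb{C}$ this reads $U_\alpha(\beta)=\alpha^2\beta$. An element $a$ is invertible if there is $b\in\mathfrak{A}$ with $a\circ b=\mathbf{1}$ and $a^2\circ b=a$. The (Jordan-)spectrum of $a$ is $\text{J-}\sigma(a)=\{\lambda\in\mathbb{C}: a-\lambda\mathbf{1}\text{ is not invertible}\}$. A functional $\psi$ is (Jordan-)multiplicative if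 $\psi(x\circ y)=\psi(x)\psi(y)$ for all $x,y\in\mathfrak{A}$. *)

theory Defs
  imports "HOL-Analysis.Analysis"
begin

text \<open>
  The libraries have no type class of complex Banach spaces.  The class \<open>banach\<close> supplies the
  underlying real Banach space; the complex scalar multiplication is a parameter \<open>cscale\<close>, required
  to extend the real one and to be compatible with the norm.
\<close>

locale complex_banach_space = vector_space cscale
  for cscale :: "complex \<Rightarrow> 'a::banach \<Rightarrow> 'a" +
  assumes cscale_of_real: "cscale (complex_of_real r) x = r *\<^sub>R x"
    and norm_cscale: "norm (cscale c x) = cmod c * norm x"

text \<open>
  \<open>Vector_Spaces.linear\<close> is linearity over the field of the two given scalar multiplications, here
  the complex numbers; the unqualified \<open>linear\<close> would only be linearity over the reals.
\<close>

locale complex_jordan_banach_algebra = complex_banach_space cscale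
  for cscale :: "complex \<Rightarrow> 'a::banach \<Rightarrow> 'a" +
  fixes jprod :: "'a \<Rightarrow> 'a \<Rightarrow> 'a"
  assumes jprod_linear_left: "Vector_Spaces.linear cscale cscale (\<lambda>a. jprod a b)"
    and jprod_linear_right: "Vector_Spaces.linear cscale cscale (\<lambda>b. jprod a b)"
    and norm_jprod_le: "norm (jprod a b) \<le> norm a * norm b"
    and jprod_commute: "jprod a b = jprod b a"
    and jordan_identity:
      "jprod (jprod (jprod a a) b) a = jprod (jprod a b) (jprod a a)"

text \<open>Neither \<open>jone \<noteq> 0\<close> nor \<open>norm jone = 1\<close> is required.\<close>

locale unital_complex_jordan_banach_algebra = complex_jordan_banach_algebra cscale jprod
  for cscale :: "complex \<Rightarrow> 'a::banach \<Rightarrow> 'a" and jprod :: "'a \<Rightarrow> 'a \<Rightarrow> 'a" +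
  fixes jone :: 'a
  assumes jone_left: "jprod jone a = a"

definition jordan_U ::
    "(complex \<Rightarrow> 'a::banach \<Rightarrow> 'a) \<Rightarrow> ('a \<Rightarrow> 'a \<Rightarrow> 'a) \<Rightarrow> 'a \<Rightarrow> 'a \<Rightarrow> 'a" where
  "jordan_U cscale jprod a b = cscale 2 (jprod (jprod a b) a) - jprod (jprod a a) b"

definition jordan_invertible :: "('a \<Rightarrow> 'a \<Rightarrow> 'a) \<Rightarrow> 'a \<Rightarrow> 'a \<Rightarrow> bool" where
  "jordan_invertible jprod jone a \<longleftrightarrow> (\<exists>b. jprod a b = jone \<and> jprod (jprod a a) b = a)"

definition jordan_spectrum ::
    "(complex \<Rightarrow> 'a::banach \<Rightarrow> 'a) \<Rightarrow> ('a \<Rightarrow> 'a \<Rightarrow> 'a) \<Rightarrow> 'a \<Rightarrow> 'a \<Rightarrow> complex set" where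
  "jordan_spectrum cscale jprod jone a =
     {l. \<not> jordan_invertible jprod jone (a - cscale l jone)}"

definition jordan_multiplicative :: "('a \<Rightarrow> 'a \<Rightarrow> 'a) \<Rightarrow> ('a \<Rightarrow> complex) \<Rightarrow> bool" where
  "jordan_multiplicative jprod \<psi> \<longleftrightarrow> (\<forall>x y. \<psi> (jprod x y) = \<psi> x * \<psi> y)"

end

theory Submission
  imports Defs "HOL-Computational_Algebra.Fundamental_Theorem_Algebra"
begin

text \<open>
  Let \<open>g(a) = f(1 + a) - 1\<close>.  Condition (b) gives \<open>|g(a)| \<le> \<parallel>a\<parallel>\<close>, and (a) makes \<open>f\<close>
  Lipschitz near \<open>1\<close>; expanding
  \<open>U\<^bsub>1 + a/2\<^esub>(1 + b) = 1 + a + b + O((\<parallel>a\<parallel> + \<parallel>b\<parallel>)\<^sup>2)\<close> then shows that \<open>g\<close> is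
  additive up to a quadratic error.  Hence \<open>g\<close> has a real-linear tangent \<open>\<phi>\<close> at \<open>0\<close>, namely
  \<open>\<phi>(a) = lim 2\<^sup>m g(a/2\<^sup>m)\<close>.  As \<open>\<phi>(a)\<close> is a limit of spectral values of \<open>a\<close>, it is nonzero
  for invertible \<open>a\<close>.  A Gleason--Kahane--Zelazko argument, run with the polynomials
  \<open>\<phi>((1 - \<mu> x)\<^sup>n)\<close>, makes \<open>\<phi>\<close> complex linear and multiplicative.

  Since \<open>f - \<phi>\<close> is of second order at \<open>1\<close> and both maps respect squares, taking repeated
  square roots gives \<open>f = \<phi>\<close> near \<open>1\<close>.  Finally the open set where \<open>f = \<phi>\<close> locally is
  relatively closed in the invertible elements: a point near \<open>y\<close> has the form
  \<open>U\<^bsub>z\<^esub>(y\<^sup>-\<^sup>1)\<close> with \<open>z\<close> closer to \<open>y\<close> by a fixed factor, and the size of the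
  neighbourhood needed depends only on \<open>\<parallel>y\<^sup>-\<^sup>1\<parallel>\<close>, which is locally bounded.
\<close>

section \<open>Roots of polynomials and additive tangents\<close>

text \<open>By Newton's identity the left side is the sum of the squares of the reciprocal roots: at
  most \<open>n\<close> of them, each of modulus at most \<open>R\<close>. The induction splits off
  one root at a time.\<close>

lemma poly_roots_newton_bound:
  fixes p :: "complex poly"
  assumes "degree p \<le> n" and "coeff p 0 = 1" and "R \<ge> 0"
    and "\<And>z. cmod z * R < 1 \<Longrightarrow> poly p z \<noteq> 0"
  shows "cmod ((coeff p 1)\<^sup>2 - 2 * coeff p 2) \<le> n * R\<^sup>2"
  using assms
proof (induction n arbitrary: p)
  case 0
  then have "coeff p 1 = 0" "coeff p 2 = 0"
    by (auto intro: coeff_eq_0)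
  then show ?case by simp
next
  case (Suc n)
  show ?case
  proof (cases "degree p = 0")
    case True
    then have "coeff p 1 = 0" "coeff p 2 = 0"
      by (auto intro: coeff_eq_0)
    then show ?thesis by simp
  next
    case False
    then obtain z where z: "poly p z = 0"
      using fundamental_theorem_of_algebra[of p] by (auto simp: constant_degree)
    have z0: "z \<noteq> 0"
      using z Suc.prems(2) by (auto simp: poly_0_coeff_0)
    define b where "b = 1 / z"
    obtain q0 where q0: "p = [:- z, 1:] * q0"
      using z by (auto simp: poly_eq_0_iff_dvd)
    define q where "q = smult (- z) q0"
    have p: "p = [:1, - b:] * q"
    proof -
      have "[:- z, 1:] = smult (- z) [:1, - b:]"
        using z0 by (simp add: b_def)
      then show ?thesis
        by (simp only: q0 q_def mult_smult_left mult_smult_right)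
    qed
    have "p \<noteq> 0"
      using Suc.prems(2) by auto
    then have "[:1, - b:] \<noteq> 0" "q \<noteq> 0"
      by (auto simp: p)
    then have "degree p = Suc (degree q)"
      using z0 unfolding p by (subst degree_mult_eq) (auto simp: b_def)
    then have dq: "degree q \<le> n"
      using Suc.prems(1) by simp
    have c: "coeff p 0 = coeff q 0" "coeff p 1 = coeff q 1 - b * coeff q 0"
      "coeff p 2 = coeff q 2 - b * coeff q 1"
      by (simp_all add: p numeral_2_eq_2)
    have "cmod z * R \<ge> 1"
      using Suc.prems(4)[of z] z by force
    then have bR: "cmod b \<le> R"
      using z0 by (simp add: b_def norm_divide field_simps)
    have "cmod ((coeff q 1)\<^sup>2 - 2 * coeff q 2) \<le> n * R\<^sup>2"
    proof (rule Suc.IH[OF dq _ Suc.prems(3)])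
      show "coeff q 0 = 1" using c Suc.prems(2) by simp
      show "poly q w \<noteq> 0" if "cmod w * R < 1" for w
        using Suc.prems(4)[OF that] by (auto simp: p)
    qed
    moreover have "(coeff p 1)\<^sup>2 - 2 * coeff p 2 = ((coeff q 1)\<^sup>2 - 2 * coeff q 2) + b\<^sup>2"
    proof -
      have p1: "coeff p 1 = coeff q 1 - b"
        using c Suc.prems(2) by simp
      then show ?thesis
        unfolding c(3) p1 by (simp add: power2_eq_square algebra_simps)
    qed
    moreover have "cmod (b\<^sup>2) \<le> R\<^sup>2"
      using bR by (simp add: norm_power power_mono)
    ultimately have "cmod ((coeff p 1)\<^sup>2 - 2 * coeff p 2) \<le> n * R\<^sup>2 + R\<^sup>2"
      by (metis add_mono norm_triangle_le)
    then show ?thesis by (simp add: algebra_simps)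
  qed
qed

text \<open>A Hyers--Ulam construction: \<open>g\<close> is additive up to second order at \<open>0\<close>, so its dilates
  converge to an additive map.\<close>

lemma additive_tangent:
  fixes g :: "'a::real_normed_vector \<Rightarrow> 'b::banach"
  assumes bound: "\<And>a. norm (g a) \<le> norm a"
    and quad: "\<And>a b. norm (g (a + b) - g a - g b) \<le> C * (norm a + norm b)\<^sup>2"
  obtains \<phi> where "linear \<phi>" "\<And>a. norm (\<phi> a) \<le> norm a"
    "\<And>a. (\<lambda>m. 2 ^ m *\<^sub>R g (a /\<^sub>R 2 ^ m)) \<longlonglongrightarrow> \<phi> a"
    "\<And>a. norm (g a - \<phi> a) \<le> 2 * C * (norm a)\<^sup>2"
proof -
  have A: "2 ^ m * (C * (x / 2 ^ m)\<^sup>2) = C * x\<^sup>2 * (1/2) ^ m" for x :: real and m :: nat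
  proof -
    have "k * (C * (x / k)\<^sup>2) = C * x\<^sup>2 * (1 / k)" if "k > 0" for k :: real
      using that by (simp add: power2_eq_square)
    from this[of "2 ^ m"] show ?thesis
      by (simp only: power_one_over zero_less_power zero_less_numeral)
  qed
  define s where "s a m = 2 ^ m *\<^sub>R g (a /\<^sub>R 2 ^ m)" for a and m :: nat
  have sb: "norm (s a m) \<le> norm a" for a m
  proof -
    have "norm (s a m) \<le> 2 ^ m * norm (a /\<^sub>R 2 ^ m)"
      using bound[of "a /\<^sub>R 2 ^ m"] by (simp add: s_def)
    then show ?thesis by (simp add: field_simps)
  qed
  \<comment> \<open>Consecutive dilates differ by the additivity defect of \<open>g\<close> at
    \<open>(c, c)\<close>, magnified by 2^m. The defect is quadratic in \<open>c\<close>, so the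
    differences form a geometric series.\<close>
  have step: "norm (s a (Suc m) - s a m) \<le> C * (norm a)\<^sup>2 * (1/2) ^ m" for a m
  proof -
    define c where "c = a /\<^sub>R 2 ^ Suc m"
    have c2: "a /\<^sub>R 2 ^ m = c + c"
      by (simp add: c_def flip: scaleR_2)
    have nc: "norm c = inverse (2 * 2 ^ m) * norm a"
      by (simp add: c_def)
    have "s a (Suc m) - s a m = - (2 ^ m *\<^sub>R (g (c + c) - g c - g c))"
      unfolding s_def c2 c_def[symmetric] by (simp add: scaleR_2 algebra_simps flip: scaleR_scaleR)
    then have "norm (s a (Suc m) - s a m) = 2 ^ m * norm (g (c + c) - g c - g c)"
      by simp
    also have "\<dots> \<le> 2 ^ m * (C * (norm c + norm c)\<^sup>2)"
      using quad[of c c] by simp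
    also have "norm c + norm c = norm a / 2 ^ m"
      using nc by (simp add: field_simps)
    also have "2 ^ m * (C * (norm a / 2 ^ m)\<^sup>2) = C * (norm a)\<^sup>2 * (1/2) ^ m"
      by (rule A)
    finally show ?thesis .
  qed
  have s0: "s a 0 = g a" for a
    by (simp add: s_def)
  have summ: "summable (\<lambda>m. C * (norm a)\<^sup>2 * (1/2) ^ m)" for a
    by (intro summable_mult summable_geometric) simp
  have summ2: "summable (\<lambda>m. norm (s a (Suc m) - s a m))" for a
    by (rule summable_comparison_test[OF _ summ[of a]]) (use step in auto)
  define \<phi> where "\<phi> a = g a + (\<Sum>m. s a (Suc m) - s a m)" for a
  have lim: "s a \<longlonglongrightarrow> \<phi> a" for a
  proof -
    have "(\<lambda>n. \<Sum>m<n. s a (Suc m) - s a m) \<longlonglongrightarrow> (\<Sum>m. s a (Suc m) - s a m)"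
      by (intro summable_LIMSEQ summable_norm_cancel[OF summ2])
    then have "(\<lambda>n. s a n - s a 0) \<longlonglongrightarrow> (\<Sum>m. s a (Suc m) - s a m)"
      by (simp only: sum_lessThan_telescope)
    then have "(\<lambda>n. s a 0 + (s a n - s a 0)) \<longlonglongrightarrow> s a 0 + (\<Sum>m. s a (Suc m) - s a m)"
      by (intro tendsto_intros)
    then show ?thesis by (simp add: \<phi>_def s0)
  qed
  have b\<phi>: "norm (\<phi> a) \<le> norm a" for a
    by (rule LIMSEQ_le_const2[OF tendsto_norm[OF lim]]) (use sb in auto)
  have close: "norm (g a - \<phi> a) \<le> 2 * C * (norm a)\<^sup>2" for a
  proof -
    have "norm (\<phi> a - g a) \<le> (\<Sum>m. norm (s a (Suc m) - s a m))"
      unfolding \<phi>_def using summable_norm[OF summ2] by simp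
    also have "\<dots> \<le> (\<Sum>m. C * (norm a)\<^sup>2 * (1/2) ^ m)"
      by (intro suminf_le step summ summ2)
    also have "\<dots> = 2 * C * (norm a)\<^sup>2"
      by (simp add: suminf_mult suminf_geometric)
    finally show ?thesis by (simp add: norm_minus_commute)
  qed
  have add: "\<phi> (a + b) = \<phi> a + \<phi> b" for a b
  proof -
    have "(\<lambda>m. s (a + b) m - s a m - s b m) \<longlonglongrightarrow> 0"
    proof (rule Lim_null_comparison)
      show "\<forall>\<^sub>F m in sequentially. norm (s (a + b) m - s a m - s b m)
          \<le> C * (norm a + norm b)\<^sup>2 * (1/2) ^ m"
      proof (rule always_eventually, rule allI)
        fix m
        have "norm (s (a + b) m - s a m - s b m)
          = 2 ^ m * norm (g (a /\<^sub>R 2 ^ m + b /\<^sub>R 2 ^ m) - g (a /\<^sub>R 2 ^ m) - g (b /\<^sub>R 2 ^ m))"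
          by (simp add: s_def scaleR_add_right flip: scaleR_diff_right)
        also have "\<dots> \<le> 2 ^ m * (C * (norm (a /\<^sub>R 2 ^ m) + norm (b /\<^sub>R 2 ^ m))\<^sup>2)"
          by (intro mult_left_mono quad) simp
        also have "norm (a /\<^sub>R 2 ^ m) + norm (b /\<^sub>R 2 ^ m) = (norm a + norm b) / 2 ^ m"
          by (simp add: field_simps)
        also have "2 ^ m * (C * ((norm a + norm b) / 2 ^ m)\<^sup>2) = C * (norm a + norm b)\<^sup>2 * (1/2) ^ m"
          by (rule A)
        finally show "norm (s (a + b) m - s a m - s b m) \<le> C * (norm a + norm b)\<^sup>2 * (1/2) ^ m" .
      qed
      show "(\<lambda>m. C * (norm a + norm b)\<^sup>2 * (1 / 2) ^ m) \<longlonglongrightarrow> 0"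
        by (intro tendsto_mult_right_zero LIMSEQ_realpow_zero) auto
    qed
    moreover have "(\<lambda>m. s (a + b) m - s a m - s b m) \<longlonglongrightarrow> \<phi> (a + b) - \<phi> a - \<phi> b"
      by (intro tendsto_intros lim)
    ultimately have "\<phi> (a + b) - \<phi> a - \<phi> b = 0"
      using LIMSEQ_unique by blast
    then show ?thesis by (simp add: algebra_simps)
  qed
  interpret \<phi>: additive \<phi> by unfold_locales (rule add)
  have nat: "\<phi> (real n *\<^sub>R a) = real n *\<^sub>R \<phi> a" for n a
    by (induction n) (simp_all add: \<phi>.zero add scaleR_left_distrib)
  have int: "\<phi> (of_int k *\<^sub>R a) = of_int k *\<^sub>R \<phi> a" for k a
  proof (cases k)
    case (nonneg n)
    then show ?thesis by (simp add: nat)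
  next
    case (neg n)
    then show ?thesis
      using nat[of "Suc n" a]
      by (simp only: of_int_minus of_int_of_nat_eq scaleR_minus_left \<phi>.minus)
  qed
  \<comment> \<open>Additivity handles the integer part of \<open>N * r\<close> exactly; the
    fractional part contributes at most \<open>2 * norm a\<close>, whatever \<open>N\<close>
    is.\<close>
  have "\<phi> (r *\<^sub>R a) = r *\<^sub>R \<phi> a" for r a
  proof -
    have "norm (\<phi> (r *\<^sub>R a) - r *\<^sub>R \<phi> a) \<le> 2 * norm a * inverse (real (Suc n))" for n
    proof -
      define N where "N = real (Suc n)"
      have N: "N > 0" by (simp add: N_def)
      have "N *\<^sub>R \<phi> (r *\<^sub>R a) = \<phi> (N *\<^sub>R r *\<^sub>R a)"
        using nat[of "Suc n" "r *\<^sub>R a"] by (simp add: N_def)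
      also have "N *\<^sub>R r *\<^sub>R a = of_int \<lfloor>N * r\<rfloor> *\<^sub>R a + frac (N * r) *\<^sub>R a"
        by (simp add: frac_def algebra_simps)
      finally have h: "N *\<^sub>R \<phi> (r *\<^sub>R a) = of_int \<lfloor>N * r\<rfloor> *\<^sub>R \<phi> a + \<phi> (frac (N * r) *\<^sub>R a)"
        by (simp only: add int)
      have "N *\<^sub>R r *\<^sub>R \<phi> a = of_int \<lfloor>N * r\<rfloor> *\<^sub>R \<phi> a + frac (N * r) *\<^sub>R \<phi> a"
        by (simp add: frac_def algebra_simps)
      then have "N *\<^sub>R (\<phi> (r *\<^sub>R a) - r *\<^sub>R \<phi> a) = \<phi> (frac (N * r) *\<^sub>R a) - frac (N * r) *\<^sub>R \<phi> a"
        unfolding scaleR_diff_right h by simp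
      also have "norm \<dots> \<le> norm (frac (N * r) *\<^sub>R a) + norm (frac (N * r) *\<^sub>R \<phi> a)"
        by (intro order_trans[OF norm_triangle_ineq4] add_mono b\<phi> order_refl)
      also have "\<dots> \<le> 1 * norm a + 1 * norm a"
        unfolding norm_scaleR
        by (intro add_mono mult_mono b\<phi>) (auto simp: frac_lt_1 less_imp_le)
      finally have "N * norm (\<phi> (r *\<^sub>R a) - r *\<^sub>R \<phi> a) \<le> 2 * norm a"
        using N by simp
      then show ?thesis
        using N unfolding N_def[symmetric] by (simp add: field_simps)
    qed
    moreover have "(\<lambda>n. 2 * norm a * inverse (real (Suc n))) \<longlonglongrightarrow> 0"
      by (intro tendsto_mult_right_zero LIMSEQ_inverse_real_of_nat)
    ultimately have "norm (\<phi> (r *\<^sub>R a) - r *\<^sub>R \<phi> a) \<le> 0"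
      by (intro LIMSEQ_le_const) auto
    then show ?thesis by simp
  qed
  then have "linear \<phi>"
    using add by (intro linearI) auto
  then show ?thesis
    by (rule that[OF _ b\<phi> lim[unfolded s_def] close])
qed

section \<open>Jordan identities and inverses\<close>

context unital_complex_jordan_banach_algebra
begin

notation jprod (infixl "\<odot>" 70)

lemma cscale_2: "cscale 2 x = 2 *\<^sub>R x"
  using cscale_of_real[of 2 x] by simp

lemma scaleR_eq: "r *\<^sub>R x = cscale (of_real r) x"
  by (simp add: cscale_of_real)

lemma jprod_cscale_left: "cscale c a \<odot> b = cscale c (a \<odot> b)"
  by (rule module_hom.scale) (use jprod_linear_left[of b] in \<open>simp add: linear_iff_module_hom\<close>)

lemma jprod_cscale_right: "a \<odot> cscale c b = cscale c (a \<odot> b)"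
  by (metis jprod_cscale_left jprod_commute)

lemma bounded_bilinear_jprod: "bounded_bilinear (\<odot>)"
proof
  show "(a + a') \<odot> b = a \<odot> b + a' \<odot> b" for a a' b
    using module_hom.add[of cscale cscale "\<lambda>a. a \<odot> b"] jprod_linear_left[of b]
    by (simp add: linear_iff_module_hom)
  show "a \<odot> (b + b') = a \<odot> b + a \<odot> b'" for a b b'
    using module_hom.add[of cscale cscale "\<lambda>b. a \<odot> b"] jprod_linear_right[of a]
    by (simp add: linear_iff_module_hom)
  show "(r *\<^sub>R a) \<odot> b = r *\<^sub>R (a \<odot> b)" for r a b
    by (simp add: scaleR_eq jprod_cscale_left)
  show "a \<odot> (r *\<^sub>R b) = r *\<^sub>R (a \<odot> b)" for r a b
    by (simp add: scaleR_eq jprod_cscale_right)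
  show "\<exists>K. \<forall>a b. norm (a \<odot> b) \<le> norm a * norm b * K"
    by (rule exI[of _ 1]) (simp add: norm_jprod_le)
qed

sublocale jp: bounded_bilinear "(\<odot>)"
  by (rule bounded_bilinear_jprod)

lemmas jlin = jp.add_left jp.add_right jp.diff_left jp.diff_right jp.minus_left jp.minus_right
  jp.scaleR_left jp.scaleR_right jp.zero_left jp.zero_right

lemma jone_right: "a \<odot> jone = a"
  by (simp add: jprod_commute[of a] jone_left)

text \<open>\<open>J\<close> is a homogeneous cubic that vanishes identically. Inclusion-exclusion
  isolates its trilinear part, which is twice the difference of the two sides.\<close>

lemma jordan_polarized:
  "(a \<odot> b) \<odot> (c \<odot> d) + (b \<odot> c) \<odot> (a \<odot> d) + (c \<odot> a) \<odot> (b \<odot> d)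
   = c \<odot> ((a \<odot> b) \<odot> d) + a \<odot> ((b \<odot> c) \<odot> d) + b \<odot> ((c \<odot> a) \<odot> d)"
proof -
  define J where "J x = (x \<odot> x) \<odot> (x \<odot> d) - x \<odot> ((x \<odot> x) \<odot> d)" for x
  have J0: "J x = 0" for x
    using jordan_identity[of x d] by (simp add: J_def jprod_commute)
  have "J (a + b + c) - J (a + b) - J (b + c) - J (c + a) + J a + J b + J c
    = 2 *\<^sub>R (((a \<odot> b) \<odot> (c \<odot> d) + (b \<odot> c) \<odot> (a \<odot> d) + (c \<odot> a) \<odot> (b \<odot> d))
    - (c \<odot> ((a \<odot> b) \<odot> d) + a \<odot> ((b \<odot> c) \<odot> d) + b \<odot> ((c \<odot> a) \<odot> d)))"
    unfolding J_def
    by (simp add: jlin scaleR_2 jprod_commute[of b a] jprod_commute[of c b] jprod_commute[of a c]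
        algebra_simps)
  then show ?thesis
    by (simp add: J0)
qed

text \<open>In \<open>jordan_polarized\<close> the left-hand side is symmetric in all four variables, so the right-hand
  side may be compared with itself after exchanging \<open>c\<close> and \<open>d\<close>.\<close>

lemma jordan_L:
  "((a \<odot> b) \<odot> c) \<odot> d = c \<odot> ((a \<odot> b) \<odot> d) + a \<odot> ((b \<odot> c) \<odot> d) + b \<odot> ((c \<odot> a) \<odot> d)
    - a \<odot> (c \<odot> (b \<odot> d)) - b \<odot> (c \<odot> (a \<odot> d))"
  using jordan_polarized[of a b c d] jordan_polarized[of a b d c]
  by (simp add: jprod_commute algebra_simps)

abbreviation U where "U \<equiv> jordan_U cscale (\<odot>)"

lemma U_eq: "U a b = 2 *\<^sub>R (a \<odot> (a \<odot> b)) - (a \<odot> a) \<odot> b"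
  by (simp add: jordan_U_def cscale_2 jprod_commute)

abbreviation inv_pair where
  "inv_pair x u \<equiv> x \<odot> u = jone \<and> (x \<odot> x) \<odot> u = x"

abbreviation jinvertible where
  "jinvertible \<equiv> jordan_invertible (\<odot>) jone"

lemma sq_comm: "(x \<odot> x) \<odot> (x \<odot> b) = x \<odot> ((x \<odot> x) \<odot> b)"
  using jordan_identity[of x b] by (simp add: jprod_commute)

lemma scaleR_3: "3 *\<^sub>R a = a + a + a" for a :: 'a
proof -
  have "3 *\<^sub>R a = (1 + 1 + 1) *\<^sub>R a"
    by simp
  then show ?thesis
    by (simp only: scaleR_left_distrib scaleR_one)
qed

context
  fixes x u
  assumes xu: "x \<odot> u = jone" and xxu: "(x \<odot> x) \<odot> u = x"
begin

lemma ux: "u \<odot> x = jone"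
  using xu by (simp add: jprod_commute)

text \<open>Polarize at \<open>x, x, u\<close>: the terms containing
  \<open>x \<odot> u = jone\<close> cancel.\<close>

lemma sq_inv_comm: "(x \<odot> x) \<odot> (u \<odot> b) = u \<odot> ((x \<odot> x) \<odot> b)"
  using jordan_polarized[of x x u b] by (simp add: xu ux jone_left)

lemma inv_sq_comm: "(u \<odot> u) \<odot> (x \<odot> b) = x \<odot> ((u \<odot> u) \<odot> b)"
  using jordan_polarized[of u u x b] by (simp add: xu ux jone_left)

text \<open>This makes the inverse relation symmetric. The difference \<open>w\<close> of the two
  sides is shown to multiply everything to zero, in particular the unit.\<close>

lemma jprod_inv_sq: "x \<odot> (u \<odot> u) = u"
proof -
  define v w where "v = x \<odot> (u \<odot> u)" and "w = v - u"
  have 1: "x \<odot> v = jone"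
    using inv_sq_comm[of x] sq_inv_comm[of u] xxu xu ux by (simp add: v_def jprod_commute)
  have 2: "u \<odot> v = u \<odot> u"
    using sq_comm[of u x] unfolding v_def by (simp add: ux jone_right jprod_commute[of x "u \<odot> u"])
  have xw: "x \<odot> w = 0" and uw: "u \<odot> w = 0" and wx: "w \<odot> x = 0" and wu: "w \<odot> u = 0"
    using 1 2 by (simp_all add: w_def jlin xu ux jprod_commute[of _ x] jprod_commute[of v u])
  \<comment> \<open>Write L_a for multiplication by \<open>a\<close>. Polarization gives 2
    [L_x, L_u] = [L_(x x), L_(u u)] = - 2 [L_v, L_x], so [L_w, L_x] = 0.\<close>
  have wc: "w \<odot> (x \<odot> b) = x \<odot> (w \<odot> b)" for b
  proof -
    have "2 *\<^sub>R (x \<odot> (u \<odot> b) - u \<odot> (x \<odot> b))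
        = (x \<odot> x) \<odot> ((u \<odot> u) \<odot> b) - (u \<odot> u) \<odot> ((x \<odot> x) \<odot> b)"
      using jordan_polarized[of "x \<odot> x" u u b] by (simp add: xxu jprod_commute[of u "x \<odot> x"]
          scaleR_2 algebra_simps)
    moreover have "2 *\<^sub>R (v \<odot> (x \<odot> b) - x \<odot> (v \<odot> b))
        = (u \<odot> u) \<odot> ((x \<odot> x) \<odot> b) - (x \<odot> x) \<odot> ((u \<odot> u) \<odot> b)"
      using jordan_polarized[of "u \<odot> u" x x b]
      by (simp add: v_def jprod_commute[of "u \<odot> u" x] scaleR_2 algebra_simps)
    ultimately have "2 *\<^sub>R ((x \<odot> (u \<odot> b) - u \<odot> (x \<odot> b)) + (v \<odot> (x \<odot> b) - x \<odot> (v \<odot> b))) = 0"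
      unfolding scaleR_add_right by simp
    then have "(x \<odot> (u \<odot> b) - u \<odot> (x \<odot> b)) + (v \<odot> (x \<odot> b) - x \<odot> (v \<odot> b)) = 0"
      by simp
    then show ?thesis by (simp add: w_def jlin algebra_simps)
  qed
  have "w \<odot> b = 0" for b
  proof -
    have "w \<odot> b = w \<odot> (x \<odot> (u \<odot> b)) + u \<odot> (x \<odot> (w \<odot> b))"
      using jordan_L[of w u x b] by (simp add: wu xw ux jone_left jlin algebra_simps)
    moreover have "x \<odot> (w \<odot> (u \<odot> b)) + u \<odot> (w \<odot> (x \<odot> b)) = 0"
      using jordan_L[of x u w b] by (simp add: uw wx xu jone_left jlin algebra_simps)
    ultimately show ?thesis by (simp add: wc)
  qed
  then have "w = 0" using jone_right[of w] by simp
  then show ?thesis by (simp add: w_def v_def)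
qed

end

section \<open>Commutation of multiplication by an element and by its inverse\<close>

lemma inv_pair_sym: "inv_pair x u \<Longrightarrow> inv_pair u x"
  using jprod_inv_sq[of x u] by (simp add: jprod_commute)

text \<open>Preparation for showing that the commutator \<open>D\<close> = [L_x, L_u] vanishes.
  \<open>jordan_L\<close> shows that [L_x, \<open>D\<close>] = [L_u, \<open>D\<close>] = 0; the cube
  of \<open>x\<close> supplies the further relation that makes \<open>D\<close> vanish on the range
  of \<open>U x\<close>.\<close>

lemma inv_pair_comm_aux:
  assumes "inv_pair x u"
  defines "D \<equiv> \<lambda>b. x \<odot> (u \<odot> b) - u \<odot> (x \<odot> b)"
  shows "D (x \<odot> b) = x \<odot> D b" "D (u \<odot> b) = u \<odot> D b"
    "D (U x b) = 0" "u \<odot> U x b = x \<odot> b - 2 *\<^sub>R (x \<odot> D b)" "D (x \<odot> b) = 0"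
proof -
  have xu: "x \<odot> u = jone" and xxu: "(x \<odot> x) \<odot> u = x" and ux: "u \<odot> x = jone" and uux: "(u \<odot> u) \<odot> x = u"
    using assms inv_pair_sym[of x u] by auto
  note c = sq_inv_comm[OF xu xxu] inv_sq_comm[OF xu xxu] sq_comm
  have com: "y \<odot> (y \<odot> (z \<odot> b)) + z \<odot> (y \<odot> (y \<odot> b)) = 2 *\<^sub>R (y \<odot> (z \<odot> (y \<odot> b)))"
    and com2: "z \<odot> ((y \<odot> y) \<odot> b) = 2 *\<^sub>R (y \<odot> (z \<odot> (y \<odot> b))) - y \<odot> b"
    if "inv_pair y z" for y z b
  proof -
    have yz: "y \<odot> z = jone" "z \<odot> y = jone" "(y \<odot> y) \<odot> z = y"
      using that inv_pair_sym by blast+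
    show 2: "z \<odot> ((y \<odot> y) \<odot> b) = 2 *\<^sub>R (y \<odot> (z \<odot> (y \<odot> b))) - y \<odot> b"
      using jordan_L[of y y z b] by (simp add: yz jone_left scaleR_2 algebra_simps)
    show "y \<odot> (y \<odot> (z \<odot> b)) + z \<odot> (y \<odot> (y \<odot> b)) = 2 *\<^sub>R (y \<odot> (z \<odot> (y \<odot> b)))"
      using jordan_L[of y z y b] 2 by (simp add: yz jone_left scaleR_2 algebra_simps)
  qed
  show Dx: "D (x \<odot> b) = x \<odot> D b" for b
    using com[OF assms(1), of b] by (simp add: D_def jlin scaleR_2 algebra_simps)
  show Du: "D (u \<odot> b) = u \<odot> D b" for b
    using com[OF inv_pair_sym[OF assms(1)], of b] by (simp add: D_def jlin scaleR_2 algebra_simps)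
  have PQ: "x \<odot> (u \<odot> b) = u \<odot> (x \<odot> b) + D b" for b
    by (simp add: D_def)
  have cube: "((x \<odot> x) \<odot> x) \<odot> b = 3 *\<^sub>R (x \<odot> ((x \<odot> x) \<odot> b)) - 2 *\<^sub>R (x \<odot> (x \<odot> (x \<odot> b)))" for b
    using jordan_L[of x x x b] by (simp add: scaleR_2 scaleR_3 algebra_simps)
  \<comment> \<open>Multiplication by the cube of \<open>x\<close> commutes with L_u and, by
    \<open>cube\<close>, is a polynomial in L_x and L_(x x). Moving L_u to the left on both sides
    isolates \<open>D ((x \<odot> x) \<odot> b)\<close>.\<close>
  have "((x \<odot> x) \<odot> x) \<odot> (u \<odot> b) = u \<odot> (((x \<odot> x) \<odot> x) \<odot> b)" for b
    using jordan_polarized[of "x \<odot> x" x u b] by (simp add: xu ux xxu jone_left jprod_commute[of u "x \<odot> x"])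
  then have *: "3 *\<^sub>R (x \<odot> ((x \<odot> x) \<odot> (u \<odot> b))) - 2 *\<^sub>R (x \<odot> (x \<odot> (x \<odot> (u \<odot> b))))
     = u \<odot> (3 *\<^sub>R (x \<odot> ((x \<odot> x) \<odot> b)) - 2 *\<^sub>R (x \<odot> (x \<odot> (x \<odot> b))))" for b
    by (simp add: cube)
  have "3 *\<^sub>R D ((x \<odot> x) \<odot> b) = 6 *\<^sub>R (x \<odot> (x \<odot> D b))" for b
  proof -
    have "x \<odot> (x \<odot> (x \<odot> (u \<odot> b))) = u \<odot> (x \<odot> (x \<odot> (x \<odot> b))) + 3 *\<^sub>R (x \<odot> (x \<odot> D b))"
      by (simp add: PQ jlin Dx scaleR_3)
    moreover have "x \<odot> ((x \<odot> x) \<odot> (u \<odot> b)) = u \<odot> (x \<odot> ((x \<odot> x) \<odot> b)) + D ((x \<odot> x) \<odot> b)"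
      by (simp add: c(1) PQ)
    ultimately show ?thesis
      using *[of b] by (simp add: jlin algebra_simps)
  qed
  then have "3 *\<^sub>R (D ((x \<odot> x) \<odot> b) - 2 *\<^sub>R (x \<odot> (x \<odot> D b))) = 0" for b
    by (simp add: algebra_simps)
  then have DS2: "D ((x \<odot> x) \<odot> b) = 2 *\<^sub>R (x \<odot> (x \<odot> D b))" for b
    by (metis eq_iff_diff_eq_0 scaleR_eq_0_iff zero_neq_numeral)
  have Dlin: "D (p - q) = D p - D q" "D (r *\<^sub>R p) = r *\<^sub>R D p" for p q r
    by (simp_all add: D_def jlin algebra_simps)
  show DU: "D (U x b) = 0" for b
    by (simp add: U_eq Dlin DS2 Dx)
  show QU: "u \<odot> U x b = x \<odot> b - 2 *\<^sub>R (x \<odot> D b)" for b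
    using com2[OF assms(1), of b] by (simp add: U_eq jlin PQ Dx algebra_simps)
  have UQ: "U x (u \<odot> b) = x \<odot> b + 2 *\<^sub>R (x \<odot> D b)"
  proof -
    have "U x (u \<odot> b) = u \<odot> U x b + 4 *\<^sub>R (x \<odot> D b)"
      by (simp add: U_eq PQ jlin Dx c scaleR_2[symmetric] algebra_simps)
    also have "4 *\<^sub>R (x \<odot> D b) = 2 *\<^sub>R (x \<odot> D b) + 2 *\<^sub>R (x \<odot> D b)"
      by (simp flip: scaleR_left_distrib)
    finally show ?thesis by (simp add: QU)
  qed
  \<comment> \<open>\<open>D\<close> kills both compositions of \<open>U x\<close> with L_u; the
    term \<open>D (x \<odot> D b)\<close> enters the two expansions with opposite signs and cancels
    on adding.\<close>
  have "D (u \<odot> U x b) = 0"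
    by (simp add: Du DU jlin)
  moreover have "D (u \<odot> U x b) = D (x \<odot> b) - 2 *\<^sub>R D (x \<odot> D b)"
    by (simp add: QU Dlin)
  moreover have "D (x \<odot> b) + 2 *\<^sub>R D (x \<odot> D b) = 0"
    using DU[of "u \<odot> b"] by (simp add: UQ D_def jlin algebra_simps)
  ultimately have "2 *\<^sub>R D (x \<odot> b) = 0"
    by (simp add: scaleR_2 algebra_simps)
  then show "D (x \<odot> b) = 0"
    by simp
qed

text \<open>The relations for \<open>(x, u)\<close> and \<open>(u, x)\<close> together give
  \<open>D (D b) = 0\<close> and \<open>D (U u b) = 0\<close>. Since \<open>U u (U x b)\<close> is
  \<open>b\<close> minus twice \<open>D b\<close>, applying \<open>D\<close> yields
  \<open>D b = 0\<close>.\<close>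

lemma U_inv_comm:
  assumes "inv_pair x u"
  shows "U u (U x b) = b" "x \<odot> (u \<odot> b) = u \<odot> (x \<odot> b)"
proof -
  have xu: "x \<odot> u = jone" and xxu: "(x \<odot> x) \<odot> u = x" and ux: "u \<odot> x = jone" and uux: "(u \<odot> u) \<odot> x = u"
    and sym: "inv_pair u x"
    using assms inv_pair_sym[of x u] by auto
  define D where "D = (\<lambda>b. x \<odot> (u \<odot> b) - u \<odot> (x \<odot> b))"
  have Dd: "x \<odot> (u \<odot> b) - u \<odot> (x \<odot> b) = D b" for b by (simp add: D_def)
  note A = inv_pair_comm_aux[OF assms, unfolded Dd]
  have D': "u \<odot> (x \<odot> b) - x \<odot> (u \<odot> b) = - D b" for b by (simp add: D_def)
  note B = inv_pair_comm_aux[OF sym, unfolded D', simplified]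
  have DD: "D (D b) = 0" for b
  proof -
    have "D (D b) = D (x \<odot> (u \<odot> b)) - D (u \<odot> (x \<odot> b))"
      by (simp add: D_def jlin algebra_simps)
    also have "\<dots> = 0"
      using A(5) B(5) by simp
    finally show ?thesis .
  qed
  have xD: "x \<odot> D b = 0" for b
    using A(1,5)[of b] by simp
  have xx: "(x \<odot> x) \<odot> (u \<odot> u) = jone"
    using sq_inv_comm[OF xu xxu, of u] by (simp add: xxu ux)
  have TU: "(u \<odot> u) \<odot> U x b = 2 *\<^sub>R (x \<odot> (u \<odot> b)) - b" for b
    using jordan_L[of x x "u \<odot> u" b] inv_sq_comm[OF xu xxu] uux jprod_commute[of x "u \<odot> u"]
    by (simp add: U_eq jlin xx jone_left scaleR_2 algebra_simps)
  have UU: "U u (U x b) = b - 2 *\<^sub>R D b" for b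
  proof -
    have "U u (U x b) = 2 *\<^sub>R (u \<odot> (x \<odot> b)) - (2 *\<^sub>R (x \<odot> (u \<odot> b)) - b)"
      unfolding U_eq[of u] by (simp add: A(4) TU xD jlin)
    then show ?thesis
      by (simp add: D_def algebra_simps)
  qed
  have "D b = D (U u (U x b)) + 2 *\<^sub>R D (D b)" for b
    unfolding UU by (simp add: D_def jlin algebra_simps)
  then have "D b = 0" for b
    using DD B(3) by simp
  then show "U u (U x b) = b" "x \<odot> (u \<odot> b) = u \<odot> (x \<odot> b)"
    using UU by (simp_all add: D_def)
qed

section \<open>The open set of invertible elements\<close>

lemma U_add_right: "U a (b + c) = U a b + U a c"
  and U_diff_right: "U a (b - c) = U a b - U a c"
  by (simp_all add: U_eq jlin algebra_simps)

lemma U_add_left: "U (a + w) b = U a b + 2 *\<^sub>R (a \<odot> (w \<odot> b) + w \<odot> (a \<odot> b) - (a \<odot> w) \<odot> b) + U w b"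
  by (simp add: U_eq jlin jprod_commute[of w a] scaleR_2 algebra_simps)

lemma U_jone: "U a jone = a \<odot> a"
  by (simp add: U_eq jone_right scaleR_2)

lemma norm_U_diff_le: "norm (U a b - U a' b) \<le> 3 * norm (a - a') * (norm a + norm a') * norm b"
proof -
  have "U a b - U a' b
      = 2 *\<^sub>R ((a - a') \<odot> (a \<odot> b)) + 2 *\<^sub>R (a' \<odot> ((a - a') \<odot> b)) - ((a - a') \<odot> (a + a')) \<odot> b"
    by (simp add: U_eq jlin jprod_commute[of a' a] scaleR_2 algebra_simps)
  also have "norm \<dots> \<le> 2 * norm ((a - a') \<odot> (a \<odot> b)) + 2 * norm (a' \<odot> ((a - a') \<odot> b))
      + norm (((a - a') \<odot> (a + a')) \<odot> b)"
    by (rule order_trans[OF norm_triangle_ineq4] add_mono order_trans[OF norm_triangle_ineq] order_refl)+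
      simp_all
  also have "norm ((a - a') \<odot> (a \<odot> b)) \<le> norm (a - a') * (norm a * norm b)"
    by (rule order_trans[OF norm_jprod_le]) (simp add: mult_left_mono norm_jprod_le)
  also have "norm (a' \<odot> ((a - a') \<odot> b)) \<le> norm a' * (norm (a - a') * norm b)"
    by (rule order_trans[OF norm_jprod_le]) (simp add: mult_left_mono norm_jprod_le)
  also have "norm (((a - a') \<odot> (a + a')) \<odot> b) \<le> (norm (a - a') * (norm a + norm a')) * norm b"
    by (intro order_trans[OF norm_jprod_le] mult_right_mono mult_left_mono norm_triangle_ineq norm_ge_zero)
  finally show ?thesis by (simp add: algebra_simps)
qed

lemma norm_U_le: "norm (U a b) \<le> 3 * (norm a)\<^sup>2 * norm b"
proof -
  have "U 0 b = 0" by (simp add: U_eq jlin)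
  then show ?thesis using norm_U_diff_le[of a b 0] by (simp add: power2_eq_square)
qed

lemma U_inv: "inv_pair x u \<Longrightarrow> U x u = x"
  by (simp add: U_eq jone_right scaleR_2)

text \<open>Because L_x and L_u commute, the mixed term of \<open>U_add_left\<close> collapses to
  \<open>2 *\<^sub>R w\<close>.\<close>

lemma U_inv_add:
  assumes "inv_pair x u"
  shows "U (x + w) u = x + 2 *\<^sub>R w + U w u"
proof -
  have "x \<odot> (w \<odot> u) = (x \<odot> w) \<odot> u"
    using U_inv_comm(2)[OF assms, of w] by (simp add: jprod_commute[of w u] jprod_commute[of _ u])
  then show ?thesis
    using assms by (simp add: U_add_left U_inv jone_right)
qed

lemma U_L_comm: "U x (x \<odot> b) = x \<odot> U x b"
  by (simp add: U_eq jlin sq_comm)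

lemma invertible_iff: "jinvertible x \<longleftrightarrow> (\<exists>u. inv_pair x u)"
  by (simp add: jordan_invertible_def)

lemma inv_pair_cscale:
  assumes "inv_pair x u" "c \<noteq> 0"
  shows "inv_pair (cscale c x) (cscale (1 / c) u)"
  using assms by (simp add: jprod_cscale_left jprod_cscale_right)

lemma invertible_cscale: "jinvertible x \<Longrightarrow> c \<noteq> 0 \<Longrightarrow> jinvertible (cscale c x)"
  using inv_pair_cscale invertible_iff by meson

lemma inv_pair_jone: "inv_pair jone jone"
  by (simp add: jone_left)

text \<open>\<open>U x\<close> has inverse \<open>U u\<close>, and for \<open>y\<close> near
  \<open>x\<close> the operator \<open>U y\<close> is a small perturbation of it. So
  \<open>U y\<close> is bounded below and \<open>U y v = y\<close> is solvable; the solution is the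
  inverse of \<open>y\<close>. The local bound on inverses serves the continuation along the
  component.\<close>

lemma inv_pair_near:
  assumes xu: "inv_pair x u"
  obtains r K where "r > 0" "\<And>y. norm (y - x) < r \<Longrightarrow> jinvertible y"
    "\<And>y v. norm (y - x) < r \<Longrightarrow> inv_pair y v \<Longrightarrow> norm v \<le> K"
proof -
  define C where "C = 3 * (norm u)\<^sup>2"
  define M where "M = 3 * (2 * norm x + 1)"
  \<comment> \<open>\<open>C\<close> bounds the operator norm of \<open>U u\<close>, and
    \<open>M * norm (y - x)\<close> that of \<open>U y - U x\<close> when \<open>y\<close> is within
    distance 1; thus \<open>C * M * r \<le> 1 / 2\<close>.\<close>
  define r where "r = min 1 (1 / (2 * C * M + 1))"
  have C0: "C \<ge> 0" and M0: "M > 0" by (auto simp: C_def M_def add_nonneg_pos)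
  have r0: "r > 0"
    using C0 M0 by (auto simp: r_def intro!: divide_pos_pos add_nonneg_pos)
  note UU = U_inv_comm(1)[OF xu] U_inv_comm(1)[OF inv_pair_sym[OF xu]]
  have small: "norm (U u (U y b - U x b)) \<le> 1 / 2 * norm b" if "norm (y - x) < r" for y b
  proof -
    have y: "norm (y - x) \<le> 1" "norm (y - x) \<le> 1 / (2 * C * M + 1)"
      using that by (auto simp: r_def)
    have "norm y \<le> norm x + 1"
      using y(1) norm_triangle_sub[of y x] by linarith
    then have "norm (U y b - U x b) \<le> 3 * norm (y - x) * (2 * norm x + 1) * norm b"
      by (intro order_trans[OF norm_U_diff_le] mult_right_mono mult_left_mono) auto
    then have "norm (U y b - U x b) \<le> M * norm (y - x) * norm b"
      by (simp add: M_def algebra_simps)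
    then have "norm (U u (U y b - U x b)) \<le> C * (M * norm (y - x) * norm b)"
      unfolding C_def by (intro order_trans[OF norm_U_le] mult_left_mono) auto
    also have "\<dots> = C * M * norm (y - x) * norm b" by simp
    also have "C * M * norm (y - x) \<le> C * M * (1 / (2 * C * M + 1))"
      using C0 M0 by (intro mult_left_mono y) auto
    also have "\<dots> \<le> 1 / 2"
      using C0 M0 by (simp add: field_simps add_pos_nonneg)
    finally show ?thesis by (simp add: mult_right_mono)
  qed
  have low: "norm b \<le> 2 * C * norm (U y b)" if "norm (y - x) < r" for y b
  proof -
    have "b = U u (U y b) - U u (U y b - U x b)"
      by (simp add: U_diff_right UU)
    then have "norm b \<le> norm (U u (U y b)) + norm (U u (U y b - U x b))"
      by (metis norm_triangle_ineq4)
    also have "\<dots> \<le> C * norm (U y b) + 1 / 2 * norm b"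
      unfolding C_def by (intro add_mono norm_U_le small that)
    finally show ?thesis by simp
  qed
  have inv: "jinvertible y" if y: "norm (y - x) < r" for y
  proof -
    \<comment> \<open>Since \<open>U u\<close> inverts \<open>U x\<close>, the fixed points of
      \<open>T\<close> are the solutions of \<open>U y v = y\<close>.\<close>
    define T where "T v = U u y - U u (U y v - U x v)" for v
    have "\<exists>!v. T v = v"
    proof (rule banach_fix_type[of "1/2"])
      show "\<forall>v w. dist (T v) (T w) \<le> 1 / 2 * dist v w"
      proof (intro allI)
        fix v w
        have "T v - T w = U u (U y (w - v) - U x (w - v))"
          by (simp add: T_def U_diff_right)
        then show "dist (T v) (T w) \<le> 1 / 2 * dist v w"
          using small[OF y, of "w - v"] by (simp add: dist_norm norm_minus_commute)
      qed
    qed auto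
    then obtain v where "T v = v" by blast
    then have "U x (T v) = U x v" by simp
    then have v: "U y v = y"
      by (simp add: T_def U_diff_right UU)
    \<comment> \<open>\<open>U y\<close> commutes with L_y, so \<open>y \<odot> v\<close> and
      \<open>jone\<close> have the same image \<open>y \<odot> y\<close>; the lower bound
      \<open>low\<close> makes \<open>U y\<close> injective.\<close>
    have "U y (y \<odot> v - jone) = 0"
      by (simp add: U_diff_right U_L_comm v U_jone)
    then have "y \<odot> v = jone"
      using low[OF y, of "y \<odot> v - jone"] by simp
    moreover from this v have "(y \<odot> y) \<odot> v = y"
      by (simp add: U_eq jone_right scaleR_2)
    ultimately show ?thesis by (auto simp: invertible_iff)
  qed
  have "norm v \<le> 2 * C * (norm x + 1)" if y: "norm (y - x) < r" and "inv_pair y v" for y v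
  proof -
    have "norm v \<le> 2 * C * norm y"
      using low[OF y, of v] U_inv[OF that(2)] by simp
    moreover have "norm y \<le> norm x + 1"
      using y norm_triangle_sub[of y x] by (simp add: r_def)
    ultimately show ?thesis
      using C0 by (meson mult_left_mono order_trans mult_nonneg_nonneg zero_le_numeral)
  qed
  with r0 inv that show ?thesis by blast
qed

lemma open_invertible: "open {x. jinvertible x}"
  unfolding open_dist
proof
  fix x assume "x \<in> {x. jinvertible x}"
  then obtain u where "inv_pair x u" by (auto simp: invertible_iff)
  then obtain r K where "r > 0" "\<And>y. norm (y - x) < r \<Longrightarrow> jinvertible y"
    using inv_pair_near by metis
  then show "\<exists>e>0. \<forall>y. dist y x < e \<longrightarrow> y \<in> {x. jinvertible x}"
    by (auto simp: dist_norm)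
qed

text \<open>With \<open>e = 0\<close> this solves \<open>U (x + w) u = y\<close> for \<open>u\<close> the inverse of \<open>x\<close>; with
  \<open>p = jone + e\<close> it solves \<open>U (jone + w) p = q\<close>.\<close>

lemma quadratic_equation:
  assumes small: "norm e + norm p * norm d \<le> 1 / 4"
  obtains w where "2 *\<^sub>R w + 2 *\<^sub>R (w \<odot> e) + U w p = d" "norm w \<le> 2 / 3 * norm d"
proof -
  define T where "T w = (1 / 2) *\<^sub>R (d - 2 *\<^sub>R (w \<odot> e) - U w p)" for w
  \<comment> \<open>\<open>T\<close> maps this ball into itself because (1 + 4/3 * 1/4) / 2 = 2/3;
    the same smallness assumption gives the contraction factor 1/2.\<close>
  define S where "S = cball (0::'a) (2 / 3 * norm d)"
  have T_S: "T w \<in> S" if "w \<in> S" for w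
  proof -
    have w: "norm w \<le> 2 / 3 * norm d" using that by (simp add: S_def)
    have "norm (d - 2 *\<^sub>R (w \<odot> e) - U w p) \<le> norm d + 2 * norm (w \<odot> e) + norm (U w p)"
      by (rule order_trans[OF norm_triangle_ineq4] add_mono order_refl)+ simp_all
    also have "\<dots> \<le> norm d + 2 * (2 / 3 * norm d * norm e) + 3 * (2 / 3 * norm d)\<^sup>2 * norm p"
      by (intro add_mono order_refl mult_left_mono order_trans[OF norm_jprod_le]
          order_trans[OF norm_U_le] mult_right_mono power_mono w) auto
    also have "\<dots> = norm d + 4 / 3 * norm d * (norm e + norm p * norm d)"
      by (simp add: power2_eq_square field_simps)
    also have "\<dots> \<le> norm d + 4 / 3 * norm d * (1 / 4)"
      by (intro add_mono order_refl mult_left_mono small) auto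
    finally show ?thesis by (simp add: T_def S_def)
  qed
  have "\<exists>!w\<in>S. T w = w"
  proof (rule Banach_fix[of S "1/2"])
    show "complete S" "S \<noteq> {}"
      by (auto simp: S_def complete_eq_closed)
    show "\<And>w v. w \<in> S \<Longrightarrow> v \<in> S \<Longrightarrow> dist (T w) (T v) \<le> 1 / 2 * dist w v"
    proof -
      fix w v assume "w \<in> S" "v \<in> S"
      then have w: "norm w \<le> 2 / 3 * norm d" "norm v \<le> 2 / 3 * norm d" by (auto simp: S_def)
      have "T w - T v = (1 / 2) *\<^sub>R ((2 *\<^sub>R ((v - w) \<odot> e)) - (U w p - U v p))"
        by (simp add: T_def jlin algebra_simps)
      then have "norm (T w - T v) = 1 / 2 * norm (2 *\<^sub>R ((v - w) \<odot> e) - (U w p - U v p))"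
        by simp
      also have "norm (2 *\<^sub>R ((v - w) \<odot> e) - (U w p - U v p))
          \<le> 2 * norm ((v - w) \<odot> e) + norm (U w p - U v p)"
        by (rule order_trans[OF norm_triangle_ineq4]) simp
      also have "\<dots> \<le> 2 * (norm (w - v) * norm e)
          + 3 * norm (w - v) * (2 / 3 * norm d + 2 / 3 * norm d) * norm p"
        using norm_jprod_le[of "v - w" e]
        by (intro add_mono order_trans[OF norm_U_diff_le] mult_right_mono mult_left_mono w)
          (auto simp: norm_minus_commute)
      also have "\<dots> = norm (w - v) * (2 * norm e + 4 * (norm p * norm d))"
        by (simp add: field_simps)
      also have "\<dots> \<le> norm (w - v) * 1"
        by (intro mult_left_mono) (use small norm_ge_zero[of e] in linarith, simp)
      finally show "dist (T w) (T v) \<le> 1 / 2 * dist w v"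
        by (simp add: dist_norm)
    qed
  qed (use T_S in auto)
  then obtain w where w: "w \<in> S" "T w = w" by blast
  have "2 *\<^sub>R T w = 2 *\<^sub>R w" using w(2) by simp
  then have "2 *\<^sub>R w + 2 *\<^sub>R (w \<odot> e) + U w p = d"
    by (simp add: T_def algebra_simps)
  with w that show ?thesis by (simp add: S_def)
qed

lemma solve_from_inverse:
  assumes "inv_pair y u" "norm u * norm (x - y) \<le> 1 / 4"
  obtains z where "U z u = x" "norm (z - y) \<le> 2 / 3 * norm (x - y)"
proof -
  obtain w where "2 *\<^sub>R w + 2 *\<^sub>R (w \<odot> 0) + U w u = x - y" "norm w \<le> 2 / 3 * norm (x - y)"
    using quadratic_equation[of 0 u "x - y"] assms(2) by auto
  with U_inv_add[OF assms(1), of w] show ?thesis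
    by (intro that[of "y + w"]) (simp_all add: jlin algebra_simps)
qed

section \<open>Invertibility of the powers of 1 - \<mu> x\<close>

definition resolv :: "complex \<Rightarrow> 'a \<Rightarrow> 'a \<Rightarrow> 'a" where
  "resolv \<mu> x b = b - cscale \<mu> (x \<odot> b)"

lemma norm_cscale_jprod_le: "norm (cscale \<mu> (x \<odot> b)) \<le> cmod \<mu> * norm x * norm b"
  by (simp add: norm_cscale mult.assoc mult_left_mono norm_jprod_le)

lemma inj_resolv:
  assumes "cmod \<mu> * norm x < 1" "resolv \<mu> x b = resolv \<mu> x c"
  shows "b = c"
proof -
  have "b - c = cscale \<mu> (x \<odot> (b - c))"
    using assms(2) by (simp add: resolv_def jlin scale_right_diff_distrib algebra_simps)
  then have "norm (b - c) \<le> cmod \<mu> * norm x * norm (b - c)"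
    by (metis norm_cscale_jprod_le)
  then have "norm (b - c) \<le> 0"
    using assms(1)
    by (metis linorder_not_less mult_le_cancel_right1 not_less order_antisym_conv norm_ge_zero)
  then show ?thesis by simp
qed

lemma surj_resolv:
  assumes "cmod \<mu> * norm x < 1"
  obtains b where "resolv \<mu> x b = c"
proof -
  define T where "T b = c + cscale \<mu> (x \<odot> b)" for b
  have "\<exists>!b. T b = b"
  proof (rule banach_fix_type[of "cmod \<mu> * norm x"])
    show "\<forall>v w. dist (T v) (T w) \<le> cmod \<mu> * norm x * dist v w"
    proof (intro allI)
      fix v w
      have "T v - T w = cscale \<mu> (x \<odot> (v - w))"
        by (simp add: T_def jlin scale_right_diff_distrib)
      then show "dist (T v) (T w) \<le> cmod \<mu> * norm x * dist v w"
        by (simp add: dist_norm norm_cscale_jprod_le)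
    qed
  qed (use assms in auto)
  then obtain b where "T b = b" by blast
  then have "resolv \<mu> x b = c"
    unfolding resolv_def T_def by (metis add_diff_cancel_right')
  with that show ?thesis .
qed

text \<open>The power (1 - \<mu> x)^n, encoded as an operator iterated on the unit so that no choice
  of bracketing enters.\<close>

abbreviation rpow where "rpow n \<mu> x \<equiv> (resolv \<mu> x ^^ n) jone"

definition L_comm where
  "L_comm x = {c. \<forall>b. c \<odot> (x \<odot> b) = x \<odot> (c \<odot> b) \<and> c \<odot> ((x \<odot> x) \<odot> b) = (x \<odot> x) \<odot> (c \<odot> b)}"

lemma L_comm_diff_cscale: "c \<in> L_comm x \<Longrightarrow> d \<in> L_comm x \<Longrightarrow> c - cscale \<mu> d \<in> L_comm x"
  by (simp add: L_comm_def jlin jprod_cscale_left jprod_cscale_right)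

text \<open>\<open>jordan_L\<close> expresses multiplication by
  \<open>x \<odot> (x \<odot> c)\<close> through L_x, L_(x x) and the operators of \<open>c\<close>
  and \<open>x \<odot> c\<close>. This is why \<open>L_comm\<close> also asks for commutation with
  L_(x x), and why \<open>rpow_L_comm\<close> carries two consecutive elements through its
  induction.\<close>

lemma L_comm_step:
  assumes "c \<in> L_comm x" "x \<odot> c \<in> L_comm x"
  shows "x \<odot> (x \<odot> c) \<in> L_comm x"
proof -
  have "(x \<odot> (x \<odot> c)) \<odot> d = x \<odot> ((x \<odot> c) \<odot> d) + c \<odot> ((x \<odot> x) \<odot> d) + x \<odot> ((x \<odot> c) \<odot> d)
      - c \<odot> (x \<odot> (x \<odot> d)) - x \<odot> (x \<odot> (c \<odot> d))" for d
    using jordan_L[of c x x d] by (simp add: jprod_commute[of c x] jprod_commute[of "x \<odot> c" x])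
  then show ?thesis
    using assms by (simp add: L_comm_def jlin sq_comm)
qed

lemma rpow_L_comm: "rpow n \<mu> x \<in> L_comm x \<and> x \<odot> rpow n \<mu> x \<in> L_comm x"
proof (induction n)
  case 0
  then show ?case
    by (simp add: L_comm_def jone_left jone_right sq_comm)
next
  case (Suc n)
  let ?y = "rpow n \<mu> x"
  have "rpow (Suc n) \<mu> x = ?y - cscale \<mu> (x \<odot> ?y)"
    by (simp add: resolv_def)
  moreover have "x \<odot> (?y - cscale \<mu> (x \<odot> ?y)) = x \<odot> ?y - cscale \<mu> (x \<odot> (x \<odot> ?y))"
    by (simp only: jlin jprod_cscale_right)
  ultimately show ?case
    using L_comm_diff_cscale L_comm_step Suc.IH by (metis (no_types, lifting))
qed

lemma resolv_L_comm: "c \<in> L_comm x \<Longrightarrow> (resolv \<mu> x ^^ n) (c \<odot> b) = c \<odot> (resolv \<mu> x ^^ n) b"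
  by (induction n) (simp_all add: resolv_def L_comm_def jlin jprod_cscale_right)

text \<open>\<open>?R\<close> is bijective and commutes with multiplication by \<open>?y\<close> and
  by its square. If \<open>?R v = jone\<close>, then
  \<open>?R (?y \<odot> v) = ?y = ?R jone\<close>, and \<open>?R\<close> cancels; the second inverse
  equation follows in the same way.\<close>

lemma invertible_rpow:
  assumes "cmod \<mu> * norm x < 1"
  shows "jinvertible (rpow n \<mu> x)"
proof -
  let ?R = "resolv \<mu> x ^^ n" and ?y = "rpow n \<mu> x"
  have inj: "?R b = ?R c \<Longrightarrow> b = c" for b c
  proof (induction n)
    case (Suc n)
    then show ?case
      using inj_resolv[OF assms] by simp
  qed simp
  have "\<exists>v. ?R v = jone"
  proof (induction n)
    case (Suc n)
    then obtain v where "(resolv \<mu> x ^^ n) v = jone" by blast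
    moreover obtain v' where "resolv \<mu> x v' = v" using surj_resolv[OF assms] .
    ultimately show ?case by (metis funpow_Suc_right comp_apply)
  qed auto
  then obtain v where v: "?R v = jone" by blast
  have y: "?y \<in> L_comm x" using rpow_L_comm by blast
  have "?y \<odot> ?y = ?R ?y"
    using resolv_L_comm[OF y, of n \<mu> jone] by (simp add: jone_right)
  then have yy: "?y \<odot> ?y = rpow (n + n) \<mu> x"
    by (simp only: funpow_add comp_apply)
  then have yyL: "?y \<odot> ?y \<in> L_comm x"
    by (simp only: rpow_L_comm)
  have "?R (?y \<odot> v) = ?R jone"
    by (simp add: resolv_L_comm[OF y] v jone_right)
  moreover have "?R ((?y \<odot> ?y) \<odot> v) = ?R ?y"
    unfolding resolv_L_comm[OF yyL] v jone_right by (simp only: yy funpow_add comp_apply)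
  ultimately show ?thesis
    using inj by (auto simp: invertible_iff)
qed

text \<open>For large \<open>c\<close>, the element is \<open>- c\<close> times 1 - a/c, invertible
  by the case \<open>n = 1\<close> of \<open>invertible_rpow\<close>.\<close>

lemma not_invertible_bound:
  assumes "\<not> jinvertible (a - cscale c jone)"
  shows "cmod c \<le> norm a"
proof (rule ccontr)
  assume "\<not> cmod c \<le> norm a"
  then have c: "norm a < cmod c" "c \<noteq> 0" by (auto simp: not_le intro: le_less_trans[OF norm_ge_zero])
  then have "cmod (1 / c) * norm a < 1"
    by (simp add: norm_divide field_simps)
  then have "jinvertible (rpow 1 (1 / c) a)"
    by (rule invertible_rpow)
  then have "jinvertible (cscale (- c) (rpow 1 (1 / c) a))"
    using c by (intro invertible_cscale) auto
  also have "cscale (- c) (rpow 1 (1 / c) a) = a - cscale c jone"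
    using c by (simp add: resolv_def jone_right scale_right_diff_distrib)
  finally show False using assms by simp
qed

section \<open>Square-preserving functionals\<close>

text \<open>Binomial expansion. All \<open>j\<close> are treated at once because passing from
  \<open>n\<close> to \<open>Suc n\<close> replaces \<open>p j\<close> by
  \<open>p j - pCons 0 (p (Suc j))\<close>.\<close>

lemma functional_rpow_poly:
  fixes \<theta> :: "'a \<Rightarrow> complex"
  assumes diff: "\<And>a b. \<theta> (a - b) = \<theta> a - \<theta> b" and sc: "\<And>c a. \<theta> (cscale c a) = c * \<theta> a"
  shows "\<exists>p. \<forall>j. (\<forall>\<mu>. poly (p j) \<mu> = \<theta> (((\<odot>) x ^^ j) (rpow n \<mu> x))) \<and> degree (p j) \<le> n
    \<and> coeff (p j) 0 = \<theta> (((\<odot>) x ^^ j) jone) \<and> coeff (p j) 1 = - (of_nat n * \<theta> (((\<odot>) x ^^ (j + 1)) jone))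
    \<and> 2 * coeff (p j) 2 = of_nat n * (of_nat n - 1) * \<theta> (((\<odot>) x ^^ (j + 2)) jone)"
proof (induction n)
  case 0
  show ?case
    by (rule exI[of _ "\<lambda>j. [:\<theta> (((\<odot>) x ^^ j) jone):]"]) (simp add: numeral_2_eq_2)
next
  case (Suc n)
  then obtain p where p: "\<And>j \<mu>. poly (p j) \<mu> = \<theta> (((\<odot>) x ^^ j) (rpow n \<mu> x))" "\<And>j. degree (p j) \<le> n"
    "\<And>j. coeff (p j) 0 = \<theta> (((\<odot>) x ^^ j) jone)"
    "\<And>j. coeff (p j) 1 = - (of_nat n * \<theta> (((\<odot>) x ^^ (j + 1)) jone))"
    "\<And>j. 2 * coeff (p j) 2 = of_nat n * (of_nat n - 1) * \<theta> (((\<odot>) x ^^ (j + 2)) jone)"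
    by metis
  have L: "((\<odot>) x ^^ j) (resolv \<mu> x b) = ((\<odot>) x ^^ j) b - cscale \<mu> (((\<odot>) x ^^ Suc j) b)" for j \<mu> b
    by (induction j) (simp_all add: resolv_def jlin jprod_cscale_right)
  show ?case
  proof (rule exI[of _ "\<lambda>j. p j - pCons 0 (p (Suc j))"], intro allI conjI)
    fix j \<mu>
    have "rpow (Suc n) \<mu> x = resolv \<mu> x (rpow n \<mu> x)" by simp
    then show "poly (p j - pCons 0 (p (Suc j))) \<mu> = \<theta> (((\<odot>) x ^^ j) (rpow (Suc n) \<mu> x))"
      by (simp only: L diff sc poly_diff poly_pCons p) simp
    show "degree (p j - pCons 0 (p (Suc j))) \<le> Suc n"
      using p(2)[of j] p(2)[of "Suc j"] degree_pCons_le[of 0 "p (Suc j)"]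
      by (intro degree_diff_le) linarith+
    show "coeff (p j - pCons 0 (p (Suc j))) 0 = \<theta> (((\<odot>) x ^^ j) jone)"
      by (simp add: p(3))
    have c1: "coeff (p j - pCons 0 (p (Suc j))) 1 = coeff (p j) 1 - coeff (p (Suc j)) 0"
      by simp
    show "coeff (p j - pCons 0 (p (Suc j))) 1 = - (of_nat (Suc n) * \<theta> (((\<odot>) x ^^ (j + 1)) jone))"
      unfolding c1 p by (simp add: algebra_simps)
    have c2: "coeff (p j - pCons 0 (p (Suc j))) 2 = coeff (p j) 2 - coeff (p (Suc j)) 1"
      by (simp add: numeral_2_eq_2)
    show "2 * coeff (p j - pCons 0 (p (Suc j))) 2
        = of_nat (Suc n) * (of_nat (Suc n) - 1) * \<theta> (((\<odot>) x ^^ (j + 2)) jone)"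
      unfolding c2 right_diff_distrib p by (simp add: algebra_simps)
  qed
qed

lemma functional_rpow_is_poly:
  fixes \<theta> :: "'a \<Rightarrow> complex"
  assumes "\<And>a b. \<theta> (a - b) = \<theta> a - \<theta> b" and "\<And>c a. \<theta> (cscale c a) = c * \<theta> a"
  obtains p where "\<And>\<mu>. poly p \<mu> = \<theta> (rpow n \<mu> x)"
proof -
  obtain p where "\<forall>j. \<forall>\<mu>. poly (p j) \<mu> = \<theta> (((\<odot>) x ^^ j) (rpow n \<mu> x))"
    using functional_rpow_poly[of \<theta> x n, OF assms] by blast
  then show ?thesis
    using that[of "p 0"] by (auto dest: spec[of _ 0])
qed

text \<open>The polynomial \<open>\<mu> \<mapsto> \<theta> ((1 - \<mu> x)\<^sup>n)\<close> starts with
  \<open>1 - n \<theta>(x) \<mu> + n(n-1)/2 \<theta>(x\<^sup>2) \<mu>\<^sup>2\<close>; the location of its roots forces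
  \<open>n\<^sup>2 \<theta>(x)\<^sup>2 - n(n-1) \<theta>(x\<^sup>2) = O(n)\<close>.\<close>

lemma functional_square:
  fixes \<theta> :: "'a \<Rightarrow> complex"
  assumes diff: "\<And>a b. \<theta> (a - b) = \<theta> a - \<theta> b" and sc: "\<And>c a. \<theta> (cscale c a) = c * \<theta> a"
    and one: "\<theta> jone = 1"
    and nz: "\<And>n \<mu>. cmod \<mu> * norm x < 1 \<Longrightarrow> \<theta> (rpow n \<mu> x) \<noteq> 0"
  shows "\<theta> (x \<odot> x) = (\<theta> x)\<^sup>2"
proof -
  define A where "A = (\<theta> x)\<^sup>2 - \<theta> (x \<odot> x)"
  have *: "cmod (of_nat n * A + \<theta> (x \<odot> x)) \<le> (norm x)\<^sup>2" if n: "n > 0" for n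
  proof -
    obtain p where "\<forall>j. (\<forall>\<mu>. poly (p j) \<mu> = \<theta> (((\<odot>) x ^^ j) (rpow n \<mu> x))) \<and> degree (p j) \<le> n
      \<and> coeff (p j) 0 = \<theta> (((\<odot>) x ^^ j) jone) \<and> coeff (p j) 1 = - (of_nat n * \<theta> (((\<odot>) x ^^ (j + 1)) jone))
      \<and> 2 * coeff (p j) 2 = of_nat n * (of_nat n - 1) * \<theta> (((\<odot>) x ^^ (j + 2)) jone)"
      using functional_rpow_poly[of \<theta> x n, OF diff sc] by blast
    from this[rule_format, of 0] have q: "\<And>\<mu>. poly (p 0) \<mu> = \<theta> (rpow n \<mu> x)" "degree (p 0) \<le> n"
      "coeff (p 0) 0 = 1" "coeff (p 0) 1 = - (of_nat n * \<theta> x)"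
      "2 * coeff (p 0) 2 = of_nat n * (of_nat n - 1) * \<theta> (x \<odot> x)"
      by (simp_all add: one jone_right numeral_2_eq_2)
    have "cmod ((coeff (p 0) 1)\<^sup>2 - 2 * coeff (p 0) 2) \<le> n * (norm x)\<^sup>2"
      using q nz by (intro poly_roots_newton_bound) auto
    also have "(coeff (p 0) 1)\<^sup>2 - 2 * coeff (p 0) 2 = of_nat n * (of_nat n * A + \<theta> (x \<odot> x))"
      unfolding q A_def by (simp add: power2_eq_square algebra_simps)
    finally show ?thesis
      using n by (simp add: norm_mult)
  qed
  define M where "M = (norm x)\<^sup>2 + cmod (\<theta> (x \<odot> x))"
  have bound: "real n * cmod A \<le> M" if "n > 0" for n
  proof -
    have "cmod (of_nat n * A) \<le> cmod (of_nat n * A + \<theta> (x \<odot> x)) + cmod (\<theta> (x \<odot> x))"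
      using norm_triangle_ineq4[of "of_nat n * A + \<theta> (x \<odot> x)" "\<theta> (x \<odot> x)"] by simp
    with *[OF that] show ?thesis by (simp add: M_def norm_mult)
  qed
  have "A = 0"
  proof (rule ccontr)
    assume "A \<noteq> 0"
    then obtain n where n: "M < real n * cmod A"
      using reals_Archimedean3[of "cmod A"] by auto
    have "M \<ge> 0" by (simp add: M_def)
    with n have "n > 0" by (cases n) auto
    with bound[of n] n show False by simp
  qed
  then show ?thesis by (simp add: A_def)
qed

text \<open>Split a real-linear functional into its complex-linear part \<open>\<phi>\<^sub>1\<close> and the conjugate of a
  complex-linear \<open>\<kappa>\<close>.  Rotating an invertible element by a phase shows
  \<open>|\<phi>\<^sub>1| \<noteq> |\<kappa>|\<close> on it, hence \<open>|\<phi>\<^sub>1| > |\<kappa>|\<close> along the path from \<open>1\<close> to \<open>(1 - \<mu> x)\<^sup>n\<close>.  So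
  all of \<open>\<phi>\<^sub>1\<close>, \<open>\<phi>\<^sub>1 + \<kappa>\<close>, \<open>\<phi>\<^sub>1 - \<kappa>\<close> preserve squares, which forces \<open>\<kappa>\<^sup>2 = 0\<close>.\<close>

lemma real_linear_multiplicative:
  fixes \<phi> :: "'a \<Rightarrow> complex"
  assumes lin: "linear \<phi>" and scal: "\<And>c. \<phi> (cscale c jone) = c"
    and nz: "\<And>x. jinvertible x \<Longrightarrow> \<phi> x \<noteq> 0"
  shows "\<phi> (cscale c a) = c * \<phi> a" "\<phi> (x \<odot> y) = \<phi> x * \<phi> y"
proof -
  define \<phi>1 where "\<phi>1 a = (\<phi> a - \<i> * \<phi> (cscale \<i> a)) / 2" for a
  define \<kappa> where "\<kappa> a = cnj ((\<phi> a + \<i> * \<phi> (cscale \<i> a)) / 2)" for a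
  have split: "\<phi> a = \<phi>1 a + cnj (\<kappa> a)" for a
    by (simp add: \<phi>1_def \<kappa>_def field_simps)
  have add: "\<phi> (a + b) = \<phi> a + \<phi> b" and diff: "\<phi> (a - b) = \<phi> a - \<phi> b" for a b
    using lin by (simp_all add: linear_add linear_diff)
  have cs: "\<phi> (cscale c a) = of_real (Re c) * \<phi> a + of_real (Im c) * \<phi> (cscale \<i> a)" for c a
  proof -
    have "cscale c a = Re c *\<^sub>R a + Im c *\<^sub>R cscale \<i> a"
      unfolding scaleR_eq scale_scale scale_left_distrib[symmetric]
      by (rule arg_cong[of _ _ "\<lambda>c. cscale c a"]) (simp add: complex_eq_iff)
    then show ?thesis
      using lin by (simp add: add linear_scale scaleR_conv_of_real)
  qed
  have ics: "cscale \<i> (cscale c a) = cscale (\<i> * c) a" for c a by simp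
  have cm: "c * z = of_real (Re c) * z + \<i> * (of_real (Im c) * z)" for c z
    by (simp add: complex_eq_iff)
  have sc1: "\<phi>1 (cscale c a) = c * \<phi>1 a" for c a
    unfolding \<phi>1_def ics cs[of c] cs[of "\<i> * c"]
    by (subst (2) cm) (simp add: field_simps)
  have scX: "\<kappa> (cscale c a) = c * \<kappa> a" for c a
    unfolding \<kappa>_def ics cs[of c] cs[of "\<i> * c"]
    by (subst (2) cm) (simp add: field_simps)
  have d1: "\<phi>1 (a - b) = \<phi>1 a - \<phi>1 b" and dX: "\<kappa> (a - b) = \<kappa> a - \<kappa> b" for a b
    by (simp_all add: \<phi>1_def \<kappa>_def diff scale_right_diff_distrib right_diff_distrib
        diff_divide_distrib add_divide_distrib)
  have one1: "\<phi>1 jone = 1" and oneX: "\<kappa> jone = 0"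
    using scal[of 1] scal[of \<i>] by (simp_all add: \<phi>1_def \<kappa>_def)
  have ne: "cmod (\<phi>1 y) \<noteq> cmod (\<kappa> y)" if y: "jinvertible y" for y
  proof
    assume eq: "cmod (\<phi>1 y) = cmod (\<kappa> y)"
    show False
    proof (cases "\<phi>1 y = 0")
      case True
      then have "\<phi> y = 0" using eq split[of y] by simp
      then show False using nz[OF y] by simp
    next
      case False
      \<comment> \<open>For a phase \<open>c\<close>, \<open>c * \<phi> (cscale c y)\<close> equals
        \<open>c\<^sup>2 * \<phi>1 y + cnj (\<kappa> y)\<close>; this \<open>c\<close> makes it
        vanish.\<close>
      define c where "c = csqrt (- cnj (\<kappa> y) / \<phi>1 y)"
      have c2: "c\<^sup>2 = - cnj (\<kappa> y) / \<phi>1 y" by (simp add: c_def)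
      have "cmod (c\<^sup>2) = 1"
        unfolding c2 using False by (simp add: norm_divide flip: eq)
      then have "cmod c = 1 \<or> cmod c = - 1"
        unfolding norm_power power2_eq_1_iff .
      then have c: "cmod c = 1"
        using norm_ge_zero[of c] by linarith
      then have cc: "c * cnj c = 1" by (simp add: complex_norm_square[symmetric])
      have "c * \<phi> (cscale c y) = c\<^sup>2 * \<phi>1 y + (c * cnj c) * cnj (\<kappa> y)"
        unfolding split[of "cscale c y"] by (simp add: sc1 scX power2_eq_square algebra_simps)
      also have "\<dots> = 0"
        unfolding cc c2 using False by simp
      finally have "\<phi> (cscale c y) = 0" using c by auto
      then show False using nz invertible_cscale[OF y, of c] c by force
    qed
  qed
  have less: "cmod (\<kappa> (rpow n \<mu> x)) < cmod (\<phi>1 (rpow n \<mu> x))" if \<mu>: "cmod \<mu> * norm x < 1" for n \<mu> x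
  proof (rule ccontr)
    assume neg: "\<not> ?thesis"
    obtain p where p: "\<And>\<mu>. poly p \<mu> = \<phi>1 (rpow n \<mu> x)"
      using functional_rpow_is_poly[of \<phi>1 n x, OF d1 sc1] by blast
    obtain q where q: "\<And>\<mu>. poly q \<mu> = \<kappa> (rpow n \<mu> x)"
      using functional_rpow_is_poly[of \<kappa> n x, OF dX scX] by blast
    \<comment> \<open>At 0 the power is \<open>jone\<close>, where \<open>\<phi>1\<close> is 1 and
      \<open>\<kappa>\<close> is 0. If the claim failed at 1, \<open>h\<close> would have a zero in
      between, that is, an invertible power excluded by \<open>ne\<close>.\<close>
    define h where "h t = cmod (poly p (of_real t * \<mu>)) - cmod (poly q (of_real t * \<mu>))" for t
    have r0: "rpow n 0 x = jone"
      by (induction n) (simp_all add: resolv_def)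
    have "h 1 \<le> 0" "0 \<le> h 0"
      using neg by (simp_all add: h_def p q r0 one1 oneX)
    moreover have "continuous_on {0..1} h"
      unfolding h_def by (intro continuous_intros)
    ultimately obtain t where t: "0 \<le> t" "t \<le> 1" "h t = 0"
      using IVT2'[of h 1 0 0] by auto
    have "cmod (of_real t * \<mu>) * norm x \<le> 1 * cmod \<mu> * norm x"
      using t unfolding norm_mult by (intro mult_right_mono) auto
    then have "jinvertible (rpow n (of_real t * \<mu>) x)"
      using \<mu> by (intro invertible_rpow) simp
    from ne[OF this] t(3) show False
      by (simp add: h_def p q)
  qed
  have sq: "\<phi>1 (x \<odot> x) + s * \<kappa> (x \<odot> x) = (\<phi>1 x + s * \<kappa> x)\<^sup>2" if s: "cmod s \<le> 1" for s x
  proof (rule functional_square)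
    show "\<phi>1 (rpow n \<mu> x) + s * \<kappa> (rpow n \<mu> x) \<noteq> 0" if "cmod \<mu> * norm x < 1" for n \<mu>
    proof
      assume "\<phi>1 (rpow n \<mu> x) + s * \<kappa> (rpow n \<mu> x) = 0"
      then have "cmod (\<phi>1 (rpow n \<mu> x)) = cmod s * cmod (\<kappa> (rpow n \<mu> x))"
        by (metis add_eq_0_iff norm_minus_cancel norm_mult)
      also have "\<dots> \<le> 1 * cmod (\<kappa> (rpow n \<mu> x))"
        by (intro mult_right_mono s) simp
      finally show False using less[OF that, of n] by simp
    qed
  qed (simp_all add: d1 dX sc1 scX one1 oneX algebra_simps)
  have "\<kappa> x = 0" for x
  proof -
    have "2 * (\<kappa> x)\<^sup>2 = (\<phi>1 x + 1 * \<kappa> x)\<^sup>2 + (\<phi>1 x + (- 1) * \<kappa> x)\<^sup>2 - 2 * (\<phi>1 x + 0 * \<kappa> x)\<^sup>2"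
      by (simp add: power2_eq_square algebra_simps)
    also have "\<dots> = (\<phi>1 (x \<odot> x) + 1 * \<kappa> (x \<odot> x)) + (\<phi>1 (x \<odot> x) + (- 1) * \<kappa> (x \<odot> x))
        - 2 * (\<phi>1 (x \<odot> x) + 0 * \<kappa> (x \<odot> x))"
      using sq[of 1 x] sq[of "- 1" x] sq[of 0 x]
      by (simp only: norm_one norm_minus_cancel norm_zero order_refl zero_le_one simp_thms)
    also have "\<dots> = 0"
      by simp
    finally show ?thesis by simp
  qed
  then have eq: "\<phi> a = \<phi>1 a" for a
    by (simp add: split)
  show "\<phi> (cscale c a) = c * \<phi> a" by (simp only: eq sc1)
  have sq: "\<phi> (x \<odot> x) = (\<phi> x)\<^sup>2" for x
    using sq[of 0 x] by (simp add: eq)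
  have "2 * \<phi> (x \<odot> y) = \<phi> ((x + y) \<odot> (x + y)) - \<phi> (x \<odot> x) - \<phi> (y \<odot> y)"
    by (simp add: jlin add jprod_commute[of y x])
  also have "\<dots> = 2 * (\<phi> x * \<phi> y)"
    unfolding sq by (simp add: add power2_eq_square algebra_simps)
  finally show "\<phi> (x \<odot> y) = \<phi> x * \<phi> y" by simp
qed

end

section \<open>Spectral multiplicative functionals\<close>

locale jordan_spectral_functional = unital_complex_jordan_banach_algebra cscale jprod jone
  for cscale :: "complex \<Rightarrow> 'a::banach \<Rightarrow> 'a" and jprod :: "'a \<Rightarrow> 'a \<Rightarrow> 'a" (infixl "\<odot>" 70)
    and jone :: 'a +
  fixes f :: "'a \<Rightarrow> complex"
  assumes f_U: "f (U x y) = (f x)\<^sup>2 * f y"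
    and f_spectrum: "\<not> jinvertible (x - cscale (f x) jone)"
begin

definition g where "g a = f (jone + a) - 1"

lemma f_eq: "f (jone + a) = 1 + g a"
  by (simp add: g_def)

lemma g_spectrum: "\<not> jinvertible (a - cscale (g a) jone)"
proof -
  have "a - cscale (g a) jone = (jone + a) - cscale (f (jone + a)) jone"
    by (simp add: g_def scale_left_diff_distrib)
  then show ?thesis using f_spectrum by metis
qed

lemma norm_g_le: "cmod (g a) \<le> norm a"
  using not_invertible_bound g_spectrum by blast

lemma g_scalar: "g (cscale c jone) = c"
proof (rule ccontr)
  assume "g (cscale c jone) \<noteq> c"
  then have "jinvertible (cscale (c - g (cscale c jone)) jone)"
    using inv_pair_jone invertible_iff by (intro invertible_cscale) auto
  then show False
    using g_spectrum[of "cscale c jone"] by (simp add: scale_left_diff_distrib)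
qed

lemma f_sq: "f (z \<odot> z) = (f z)\<^sup>2"
  using f_U[of z jone] g_scalar[of 0] by (simp add: U_jone g_def)

lemma f_nonzero: "jinvertible x \<Longrightarrow> f x \<noteq> 0"
  using f_spectrum[of x] by auto

lemma f_inverse:
  assumes "inv_pair x u"
  shows "f x * f u = 1"
  using f_U[of x u] U_inv[OF assms] f_nonzero[of x] assms
  by (auto simp: power2_eq_square invertible_iff)

text \<open>For \<open>a\<close>, \<open>b\<close> of at most this norm,
  \<open>norm b + norm (jone + b) * norm (a - b)\<close> is at most 3/16, within the 1/4 of
  \<open>quadratic_equation\<close>; the summand 1 absorbs \<open>norm b\<close>.\<close>

definition radius :: real where "radius = 1 / (16 * (norm jone + 1))"

lemma radius: "0 < radius" "radius \<le> 1 / 16" "(norm jone + 1) * radius = 1 / 16"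
proof -
  have "0 < 1 / (16 * c)" "1 / (16 * c) \<le> 1 / 16" "c * (1 / (16 * c)) = 1 / 16" if "c \<ge> 1" for c :: real
    using that by (simp_all add: field_simps)
  then show "0 < radius" "radius \<le> 1 / 16" "(norm jone + 1) * radius = 1 / 16"
    unfolding radius_def by (metis le_add_same_cancel2 norm_ge_zero)+
qed

text \<open>The neighbour \<open>jone + a\<close> of \<open>jone + b\<close> is \<open>U (jone + w) (jone + b)\<close> with \<open>w\<close> small, so the
  bound \<open>|f - 1| \<le> \<parallel>_ - 1\<parallel>\<close> at \<open>jone\<close> propagates to a Lipschitz estimate nearby.\<close>

lemma g_Lipschitz:
  assumes "norm a \<le> radius" "norm b \<le> radius"
  shows "cmod (g a - g b) \<le> 6 * norm (a - b)"
proof -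
  have b1: "norm b \<le> 1 / 16" "norm a \<le> 1 / 16" using assms radius(2) by auto
  have d: "norm (a - b) \<le> 2 * radius"
    using norm_triangle_ineq4[of a b] assms by linarith
  have p: "norm (jone + b) \<le> norm jone + 1"
    using norm_triangle_ineq[of jone b] b1 by linarith
  have "norm (jone + b) * norm (a - b) \<le> (norm jone + 1) * (2 * radius)"
    by (intro mult_mono p d) auto
  then have "norm b + norm (jone + b) * norm (a - b) \<le> 1 / 4"
    using radius(3) b1 by linarith
  then obtain w where w: "2 *\<^sub>R w + 2 *\<^sub>R (w \<odot> b) + U w (jone + b) = a - b"
    "norm w \<le> 2 / 3 * norm (a - b)"
    using quadratic_equation by blast
  have "U (jone + w) (jone + b) = jone + a"
    using w(1) by (simp add: U_add_left jone_left jone_right jlin)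
      (simp add: U_eq jone_left jlin scaleR_2 algebra_simps)
  then have "f (jone + a) = (f (jone + w))\<^sup>2 * f (jone + b)"
    by (metis f_U)
  then have "g a - g b = g w * (2 + g w) * (1 + g b)"
    unfolding f_eq by (simp add: power2_eq_square algebra_simps)
  then have "cmod (g a - g b) = cmod (g w) * cmod (2 + g w) * cmod (1 + g b)"
    by (simp add: norm_mult)
  also have "\<dots> \<le> norm (a - b) * 3 * 2"
  proof (intro mult_mono)
    show 1: "cmod (g w) \<le> norm (a - b)"
      using norm_g_le[of w] w(2) norm_ge_zero[of "a - b"] by linarith
    have "norm (a - b) \<le> 1"
      using norm_triangle_ineq4[of a b] b1 by linarith
    then show "cmod (2 + g w) \<le> 3"
      using norm_triangle_ineq[of 2 "g w"] 1
        norm_numeral[of "num.Bit0 num.One", where 'a = complex] by linarith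
    show "cmod (1 + g b) \<le> 2"
      using norm_triangle_ineq[of 1 "g b"] norm_g_le[of b] b1 norm_one[where 'a = complex] by linarith
  qed auto
  finally show ?thesis by simp
qed

text \<open>\<open>f_U\<close> at \<open>jone + ?h\<close> and \<open>jone + b\<close> evaluates
  \<open>g (a + b + r)\<close> up to \<open>2 * s\<^sup>2\<close>. Removing \<open>r\<close>, of
  norm at most \<open>2 * s\<^sup>2\<close>, costs \<open>12 * s\<^sup>2\<close> by the Lipschitz
  bound, whose range contains \<open>a + b + r\<close> because its norm is at most
  \<open>3 * s\<close>.\<close>

lemma g_near_additive_half:
  assumes "norm a + norm b \<le> radius / 3"
  shows "cmod (g (a + b) - 2 * g ((1 / 2) *\<^sub>R a) - g b) \<le> 14 * (norm a + norm b)\<^sup>2"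
proof -
  define s where "s = norm a + norm b"
  let ?h = "(1 / 2) *\<^sub>R a"
  have s1: "0 \<le> s" "s \<le> 1 / 48" and s3: "3 * s \<le> radius"
    using assms radius(2) by (auto simp: s_def)
  have ab: "norm a \<le> s" "norm b \<le> s" by (auto simp: s_def)
  define r where "r = a \<odot> b + U ?h jone + U ?h b"
  have "U (jone + ?h) (jone + b) = jone + (a + b + r)"
    unfolding r_def by (simp add: U_add_left jone_left jone_right jlin U_add_right)
      (simp add: U_eq jone_left jlin scaleR_2 algebra_simps flip: scaleR_left_distrib)
  then have "1 + g (a + b + r) = (1 + g ?h)\<^sup>2 * (1 + g b)"
    by (metis f_U f_eq)
  then have e: "g (a + b + r) = 2 * g ?h + g b + (g ?h * g ?h + (2 * g ?h) * g b + g ?h * g ?h * g b)"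
    by (simp add: power2_eq_square algebra_simps)
  have gh: "cmod (g ?h) \<le> s / 2" "cmod (g b) \<le> s"
    using norm_g_le[of ?h] norm_g_le[of b] ab by auto
  have "cmod (g ?h * g ?h + (2 * g ?h) * g b + g ?h * g ?h * g b)
      \<le> cmod (g ?h) * cmod (g ?h) + (2 * cmod (g ?h)) * cmod (g b) + cmod (g ?h) * cmod (g ?h) * cmod (g b)"
    by (intro order_trans[OF norm_triangle_ineq] add_mono) (simp_all add: norm_mult)
  also have "\<dots> \<le> (s / 2) * (s / 2) + (2 * (s / 2)) * s + (s / 2) * (s / 2) * 1"
    using gh s1 by (intro add_mono mult_mono mult_left_mono) auto
  also have "\<dots> \<le> 2 * s\<^sup>2"
    by (simp add: power2_eq_square)
  finally have q: "cmod (g ?h * g ?h + (2 * g ?h) * g b + g ?h * g ?h * g b) \<le> 2 * s\<^sup>2" .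
  have "norm r \<le> norm (a \<odot> b) + norm (?h \<odot> ?h) + norm (U ?h b)"
    unfolding r_def U_jone by (intro order_trans[OF norm_triangle_ineq] add_mono) auto
  also have "\<dots> \<le> s * s + (s / 2) * (s / 2) + 3 * (s / 2)\<^sup>2 * 1"
    using ab s1
    by (intro add_mono order_trans[OF norm_jprod_le] order_trans[OF norm_U_le] mult_mono power_mono
        mult_left_mono) auto
  also have "\<dots> = 2 * s\<^sup>2"
    by (simp add: power2_eq_square)
  finally have r: "norm r \<le> 2 * s\<^sup>2" .
  have "s\<^sup>2 \<le> s * 1"
    unfolding power2_eq_square using s1 by (intro mult_left_mono) auto
  then have r3: "norm r \<le> 2 * s" using r by simp
  have ab3: "norm (a + b) \<le> s"
    unfolding s_def by (rule norm_triangle_ineq)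
  have "cmod (g (a + b) - g (a + b + r)) \<le> 6 * norm ((a + b) - (a + b + r))"
    using s3 ab3 r3 s1 norm_triangle_ineq[of "a + b" r] by (intro g_Lipschitz) linarith+
  then have L: "cmod (g (a + b) - g (a + b + r)) \<le> 12 * s\<^sup>2"
    using r by simp
  have "g (a + b) - 2 * g ?h - g b = (g (a + b) - g (a + b + r))
      + (g ?h * g ?h + (2 * g ?h) * g b + g ?h * g ?h * g b)"
    unfolding e by simp
  then have "cmod (g (a + b) - 2 * g ?h - g b) \<le> 12 * s\<^sup>2 + 2 * s\<^sup>2"
    using norm_triangle_mono[OF L q] by (simp only:)
  then show ?thesis by (simp add: s_def)
qed

lemma g_near_additive:
  obtains C where "\<And>a b. cmod (g (a + b) - g a - g b) \<le> C * (norm a + norm b)\<^sup>2"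
proof -
  define \<delta> where "\<delta> = radius / 3"
  have \<delta>: "\<delta> > 0" by (simp add: \<delta>_def radius)
  have "cmod (g (a + b) - g a - g b) \<le> (28 + 2 / \<delta>) * (norm a + norm b)\<^sup>2" for a b
  proof (cases "norm a + norm b \<le> \<delta>")
    case True
    let ?h = "(1 / 2) *\<^sub>R a"
    have 1: "cmod (g (a + b) - 2 * g ?h - g b) \<le> 14 * (norm a + norm b)\<^sup>2"
      using True by (intro g_near_additive_half) (simp add: \<delta>_def)
    \<comment> \<open>The instance \<open>b = 0\<close> trades \<open>2 * g ?h\<close> for
      \<open>g a\<close>.\<close>
    have "norm a + norm (0::'a) \<le> \<delta>" using True norm_ge_zero[of b] unfolding norm_zero by linarith
    then have "cmod (g (a + 0) - 2 * g ?h - g 0) \<le> 14 * (norm a + norm (0::'a))\<^sup>2"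
      by (intro g_near_additive_half) (simp add: \<delta>_def)
    then have "cmod (g a - 2 * g ?h) \<le> 14 * (norm a)\<^sup>2"
      using norm_g_le[of 0] by simp
    also have "\<dots> \<le> 14 * (norm a + norm b)\<^sup>2"
      by (intro mult_left_mono power_mono) auto
    finally have 2: "cmod (g a - 2 * g ?h) \<le> 14 * (norm a + norm b)\<^sup>2" .
    have "g (a + b) - g a - g b = (g (a + b) - 2 * g ?h - g b) - (g a - 2 * g ?h)"
      by simp
    then have "cmod (g (a + b) - g a - g b) \<le> 14 * (norm a + norm b)\<^sup>2 + 14 * (norm a + norm b)\<^sup>2"
      using order_trans[OF norm_triangle_ineq4 add_mono[OF 1 2]] by (simp only:)
    also have "\<dots> \<le> (28 + 2 / \<delta>) * (norm a + norm b)\<^sup>2"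
      using \<delta> by (simp add: algebra_simps)
    finally show ?thesis .
  next
    case False
    define s where "s = norm a + norm b"
    have s: "s > \<delta>" using False by (simp add: s_def)
    have "cmod (g (a + b) - g a - g b) \<le> cmod (g (a + b)) + cmod (g a) + cmod (g b)"
      by (intro order_trans[OF norm_triangle_ineq4] add_mono) auto
    also have "\<dots> \<le> norm (a + b) + norm a + norm b"
      by (intro add_mono norm_g_le)
    also have "\<dots> \<le> 2 * s"
      using norm_triangle_ineq[of a b] by (simp add: s_def)
    also have "\<dots> \<le> 2 * s * (s / \<delta>)"
      using s \<delta> by (simp add: field_simps)
    also have "\<dots> \<le> (28 + 2 / \<delta>) * s\<^sup>2"
      by (simp add: power2_eq_square algebra_simps)
    finally show ?thesis by (simp add: s_def)
  qed
  with that show ?thesis by blast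
qed

section \<open>The tangent functional and agreement near the unit\<close>

lemma tangent_functional:
  obtains \<phi> K where "linear \<phi>" "\<And>a. cmod (\<phi> a) \<le> norm a" "\<And>a. cmod (g a - \<phi> a) \<le> K * (norm a)\<^sup>2"
    "\<And>c. \<phi> (cscale c jone) = c" "\<And>x. jinvertible x \<Longrightarrow> \<phi> x \<noteq> 0"
proof -
  obtain C where C: "\<And>a b. cmod (g (a + b) - g a - g b) \<le> C * (norm a + norm b)\<^sup>2"
    using g_near_additive by blast
  obtain \<phi> where \<phi>: "linear \<phi>" "\<And>a. cmod (\<phi> a) \<le> norm a"
    "\<And>a. (\<lambda>m. 2 ^ m *\<^sub>R g (a /\<^sub>R 2 ^ m)) \<longlonglongrightarrow> \<phi> a"
    "\<And>a. cmod (g a - \<phi> a) \<le> 2 * C * (norm a)\<^sup>2"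
    by (rule additive_tangent[of g C]) (use norm_g_le C in auto)
  have scal: "\<phi> (cscale c jone) = c" for c
  proof -
    have "2 ^ m *\<^sub>R g (cscale c jone /\<^sub>R 2 ^ m) = c" for m :: nat
      by (simp add: scaleR_eq g_scalar scaleR_conv_of_real)
    then have "(\<lambda>m::nat. c) \<longlonglongrightarrow> \<phi> (cscale c jone)"
      using \<phi>(3)[of "cscale c jone"] by simp
    then show ?thesis by (simp add: LIMSEQ_const_iff)
  qed
  have nz: "\<phi> x \<noteq> 0" if x: "jinvertible x" for x
  proof
    assume 0: "\<phi> x = 0"
    \<comment> \<open>Each \<open>\<mu> m\<close> is a spectral value of \<open>x\<close>, by
      rescaling one of \<open>x /\<^sub>R 2 ^ m\<close>. If they tended to 0, then
      \<open>x - cscale (\<mu> m) jone\<close> would enter the open set of invertible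
      elements.\<close>
    define \<mu> where "\<mu> m = 2 ^ m *\<^sub>R g (x /\<^sub>R 2 ^ m)" for m :: nat
    have "\<mu> \<longlonglongrightarrow> 0" using \<phi>(3)[of x] 0 by (simp add: \<mu>_def[abs_def])
    then have "(\<lambda>m. cmod (\<mu> m) * norm jone) \<longlonglongrightarrow> 0"
      by (intro tendsto_mult_left_zero tendsto_norm_zero)
    then have "(\<lambda>m. cscale (\<mu> m) jone) \<longlonglongrightarrow> 0"
      by (subst tendsto_norm_zero_iff[symmetric]) (simp add: norm_cscale)
    then have "(\<lambda>m. x - cscale (\<mu> m) jone) \<longlonglongrightarrow> x - 0"
      by (intro tendsto_intros)
    then have "\<forall>\<^sub>F m in sequentially. x - cscale (\<mu> m) jone \<in> {x. jinvertible x}"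
      using open_invertible x by (intro topological_tendstoD) auto
    then obtain m where m: "jinvertible (x - cscale (\<mu> m) jone)"
      by (auto simp: eventually_sequentially)
    have "x - cscale (\<mu> m) jone = cscale (2 ^ m) (x /\<^sub>R 2 ^ m - cscale (g (x /\<^sub>R 2 ^ m)) jone)"
      by (simp add: \<mu>_def scaleR_eq scale_right_diff_distrib scaleR_conv_of_real)
    from m[unfolded this]
    have "jinvertible (cscale (1 / 2 ^ m) (cscale (2 ^ m)
        (x /\<^sub>R 2 ^ m - cscale (g (x /\<^sub>R 2 ^ m)) jone)))"
      by (rule invertible_cscale) simp
    then show False using g_spectrum[of "x /\<^sub>R 2 ^ m"] by simp
  qed
  show ?thesis using that[OF \<phi>(1,2,4) scal nz] .
qed

text \<open>For \<open>x = z \<odot> z\<close> the error at \<open>x\<close> is the error at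
  \<open>z\<close> times \<open>f z + \<psi> z\<close>, of modulus at most 2 + 2/16 = 17/8. The
  distance to \<open>jone\<close> shrinks by 2/3, so each root multiplies the quadratic bound by 4/9
  * 17/8 = 17/18.\<close>

lemma agree_near_jone:
  fixes \<psi> :: "'a \<Rightarrow> complex"
  assumes add: "\<And>a b. \<psi> (a + b) = \<psi> a + \<psi> b"
    and mult: "\<And>a b. \<psi> (a \<odot> b) = \<psi> a * \<psi> b" and one: "\<psi> jone = 1"
    and bound: "\<And>a. cmod (\<psi> a) \<le> norm a"
    and close: "\<And>a. cmod (g a - \<psi> a) \<le> K * (norm a)\<^sup>2"
  obtains \<epsilon> where "\<epsilon> > 0" "\<And>x. norm (x - jone) < \<epsilon> \<Longrightarrow> f x = \<psi> x"
proof -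
  have small: "norm (x - jone) \<le> 1 / 16" "norm jone * norm (x - jone) \<le> 1 / 4"
    if "norm (x - jone) < radius" for x
  proof -
    have "norm jone * norm (x - jone) \<le> (norm jone + 1) * radius"
      using that by (intro mult_mono) auto
    then show "norm jone * norm (x - jone) \<le> 1 / 4"
      using radius(3) by linarith
  qed (use that radius(2) in auto)
  have K0: "0 \<le> K * (norm a)\<^sup>2" for a :: 'a
    using close[of a] norm_ge_zero order_trans by blast
  have step: "cmod (f x - \<psi> x) \<le> K * (norm (x - jone))\<^sup>2 * (17 / 18) ^ m" if "norm (x - jone) < radius" for m x
    using that
  proof (induction m arbitrary: x)
    case 0
    have "f x - \<psi> x = g (x - jone) - \<psi> (x - jone)"
      using add[of jone "x - jone"] by (simp add: g_def one)
    then show ?case using close[of "x - jone"] by simp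
  next
    case (Suc m)
    obtain z where z: "U z jone = x" "norm (z - jone) \<le> 2 / 3 * norm (x - jone)"
      using solve_from_inverse[OF inv_pair_jone small(2)[OF Suc.prems]] by blast
    have zr: "norm (z - jone) < radius"
      using z(2) Suc.prems norm_ge_zero[of "x - jone"] by linarith
    have "f x - \<psi> x = (f z - \<psi> z) * (f z + \<psi> z)"
      using z(1) unfolding U_jone by (auto simp: f_sq mult power2_eq_square algebra_simps)
    then have "cmod (f x - \<psi> x) = cmod (f z - \<psi> z) * cmod (f z + \<psi> z)"
      by (simp add: norm_mult)
    also have "\<dots> \<le> (K * (norm (z - jone))\<^sup>2 * (17 / 18) ^ m) * (17 / 8)"
    proof (intro mult_mono Suc.IH zr)
      have "f z + \<psi> z = 2 + (g (z - jone) + \<psi> (z - jone))"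
        using add[of jone "z - jone"] by (simp add: g_def one)
      also have "cmod \<dots> \<le> cmod 2 + (cmod (g (z - jone)) + cmod (\<psi> (z - jone)))"
        by (intro order_trans[OF norm_triangle_ineq] add_mono order_refl)
      also have "\<dots> \<le> cmod 2 + (norm (z - jone) + norm (z - jone))"
        by (intro add_mono order_refl norm_g_le bound)
      also have "\<dots> \<le> 17 / 8" using small(1)[OF zr] by simp
      finally show "cmod (f z + \<psi> z) \<le> 17 / 8" .
    qed (use K0 in auto)
    \<comment> \<open>\<open>K \<ge> 0\<close> is read off from \<open>close\<close> at a nonzero
      vector; for \<open>x = jone\<close> also \<open>z = jone\<close>.\<close>
    also have "K * (norm (z - jone))\<^sup>2 \<le> K * (norm ((2 / 3) *\<^sub>R (x - jone)))\<^sup>2"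
    proof (cases "x = jone")
      case True
      then show ?thesis using z(2) by simp
    next
      case False
      then have "K \<ge> 0" using K0[of "x - jone"] by (simp add: zero_le_mult_iff)
      then show ?thesis using z(2) by (intro mult_left_mono power_mono) auto
    qed
    also have "K * (norm ((2 / 3) *\<^sub>R (x - jone)))\<^sup>2 * (17 / 18) ^ m * (17 / 8)
        = K * (norm (x - jone))\<^sup>2 * (17 / 18) ^ Suc m"
      by (simp add: power_mult_distrib power2_eq_square)
    finally show ?case by (simp add: mult_right_mono)
  qed
  have "f x = \<psi> x" if "norm (x - jone) < radius" for x
  proof -
    have "(\<lambda>m. K * (norm (x - jone))\<^sup>2 * (17 / 18) ^ m) \<longlonglongrightarrow> 0"
      by (intro tendsto_mult_right_zero LIMSEQ_realpow_zero) auto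
    then have "cmod (f x - \<psi> x) \<le> 0"
      using step[OF that] by (intro LIMSEQ_le_const) auto
    then show ?thesis by simp
  qed
  with radius(1) that show ?thesis by blast
qed

text \<open>A point \<open>x\<close> close to \<open>y\<close> is \<open>U z u\<close> with \<open>z\<close> a kind of geometric mean of \<open>x\<close> and \<open>y\<close>;
  iterating this pulls \<open>x\<close> into any given neighbourhood of \<open>y\<close>.\<close>

lemma agree_propagates:
  assumes yu: "inv_pair y u" and mult: "\<And>a b. \<psi> (U a b) = (\<psi> a)\<^sup>2 * \<psi> b"
    and one: "\<psi> y * \<psi> u = 1"
    and \<epsilon>: "\<epsilon> > 0" "\<And>x. norm (x - y) < \<epsilon> \<Longrightarrow> f x = \<psi> x"
    and x: "norm u * norm (x - y) \<le> 1 / 4"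
  shows "f x = \<psi> x"
proof -
  have "f y = \<psi> y" using \<epsilon> by simp
  \<comment> \<open>Both values are the reciprocal of the common value at \<open>y\<close>.\<close>
  then have fu: "f u = \<psi> u"
    using f_inverse[OF yu] one by (metis mult_cancel_left mult_zero_left zero_neq_one)
  have *: "f x = \<psi> x" if "norm u * norm (x - y) \<le> 1 / 4" "norm (x - y) * (2 / 3) ^ m < \<epsilon>" for m x
    using that
  proof (induction m arbitrary: x)
    case 0
    then show ?case using \<epsilon> by simp
  next
    case (Suc m)
    obtain z where z: "U z u = x" "norm (z - y) \<le> 2 / 3 * norm (x - y)"
      using solve_from_inverse[OF yu Suc.prems(1)] by blast
    have "norm u * norm (z - y) \<le> norm u * norm (x - y)"
      using z(2) norm_ge_zero[of "x - y"] by (intro mult_left_mono) (linarith, simp)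
    moreover have "norm (z - y) * (2 / 3) ^ m \<le> (2 / 3 * norm (x - y)) * (2 / 3) ^ m"
      using z(2) by (intro mult_right_mono) auto
    moreover have "(2 / 3 * norm (x - y)) * (2 / 3) ^ m < \<epsilon>"
      using Suc.prems(2) by (simp add: mult_ac)
    ultimately have "f z = \<psi> z"
      using Suc.prems(1) by (intro Suc.IH) linarith+
    then show ?case
      using z(1) f_U[of z u] mult[of z u] fu by simp
  qed
  have "(\<lambda>m. norm (x - y) * (2 / 3) ^ m) \<longlonglongrightarrow> 0"
    by (intro tendsto_mult_right_zero LIMSEQ_realpow_zero) auto
  then have "\<forall>\<^sub>F m in sequentially. norm (x - y) * (2 / 3) ^ m < \<epsilon>"
    using \<epsilon>(1) by (rule order_tendstoD)
  then obtain m where "norm (x - y) * (2 / 3) ^ m < \<epsilon>"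
    by (auto simp: eventually_sequentially)
  with * x show ?thesis by blast
qed

lemma agree_on_component:
  fixes \<psi> :: "'a \<Rightarrow> complex"
  assumes mult: "\<And>a b. \<psi> (a \<odot> b) = \<psi> a * \<psi> b" and U: "\<And>a b. \<psi> (U a b) = (\<psi> a)\<^sup>2 * \<psi> b"
    and one: "\<psi> jone = 1"
    and near: "\<epsilon> > 0" "\<And>x. norm (x - jone) < \<epsilon> \<Longrightarrow> f x = \<psi> x"
    and x: "x \<in> connected_component_set {a. jinvertible a} jone"
  shows "f x = \<psi> x"
proof -
  define I where "I = {a. jinvertible a}"
  \<comment> \<open>The interior provides each point of \<open>A\<close> with a ball of agreement,
    as \<open>agree_propagates\<close> requires.\<close>
  define A where "A = I \<inter> interior {x. f x = \<psi> x}"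
  have oI: "open I" unfolding I_def by (rule open_invertible)
  have oA: "open A" unfolding A_def using oI by (intro open_Int) auto
  have agree: "f x = \<psi> x" if "x \<in> A" for x
    using that interior_subset by (auto simp: A_def)
  have ball: "\<exists>e>0. \<forall>x. norm (x - y) < e \<longrightarrow> f x = \<psi> x" if yA: "y \<in> A" for y
  proof -
    obtain e where "e > 0" "ball y e \<subseteq> {x. f x = \<psi> x}"
      using yA unfolding A_def Int_iff mem_interior by blast
    then show ?thesis
      by (intro exI[of _ e]) (auto simp: subset_iff dist_norm norm_minus_commute)
  qed
  have key: "\<exists>r>0. \<forall>y\<in>A. norm (y - x) < r \<longrightarrow> x \<in> A" if "x \<in> I" for x
  proof -
    obtain u where "inv_pair x u" using \<open>x \<in> I\<close> by (auto simp: I_def invertible_iff)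
    then obtain r K where r: "r > 0" "\<And>y v. norm (y - x) < r \<Longrightarrow> inv_pair y v \<Longrightarrow> norm v \<le> K"
      using inv_pair_near by metis
    \<comment> \<open>Points \<open>w\<close>, \<open>y\<close> within \<open>\<rho>\<close> of
      \<open>x\<close> are at most \<open>2 * \<rho>\<close> apart, and the inverse of
      \<open>y\<close> has norm at most \<open>\<bar>K\<bar> + 1\<close>; the product stays below
      1/4.\<close>
    define \<rho> where "\<rho> = min r (1 / (8 * (\<bar>K\<bar> + 1)))"
    have \<rho>: "\<rho> > 0" "\<rho> \<le> r" "\<rho> \<le> 1 / (8 * (\<bar>K\<bar> + 1))"
      using r(1) by (auto simp: \<rho>_def add_nonneg_pos)
    have "x \<in> A" if y: "y \<in> A" "norm (y - x) < \<rho>" for y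
    proof -
      obtain v where v: "inv_pair y v"
        using y by (auto simp: A_def I_def invertible_iff)
      have vK: "norm v \<le> \<bar>K\<bar> + 1"
        using r(2)[of y v] v y(2) \<rho>(2) by simp
      obtain e where e: "e > 0" "\<And>x. norm (x - y) < e \<Longrightarrow> f x = \<psi> x"
        using ball[OF y(1)] by blast
      have "f w = \<psi> w" if w: "norm (w - x) < \<rho>" for w
      proof (rule agree_propagates[OF v U _ e])
        show "\<psi> y * \<psi> v = 1" using mult[of y v] v one by simp
        have "norm (w - y) \<le> 2 * \<rho>"
          using norm_triangle_ineq4[of "w - x" "y - x"] w y(2) by simp
        then have "norm v * norm (w - y) \<le> (\<bar>K\<bar> + 1) * (2 * \<rho>)"
          using vK by (intro mult_mono) auto
        also have "\<dots> \<le> (\<bar>K\<bar> + 1) * (2 * (1 / (8 * (\<bar>K\<bar> + 1))))"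
          using \<rho>(3) by (intro mult_left_mono) auto
        also have "\<dots> = 1 / 4"
        proof -
          have "c * (2 * (1 / (8 * c))) = 1 / 4" if "c > 0" for c :: real
            using that by simp
          then show ?thesis
            by (metis abs_ge_zero add_nonneg_pos zero_less_one)
        qed
        finally show "norm v * norm (w - y) \<le> 1 / 4" .
      qed
      then have "ball x \<rho> \<subseteq> {x. f x = \<psi> x}"
        by (auto simp: dist_norm norm_minus_commute)
      then show ?thesis
        using \<open>x \<in> I\<close> \<rho>(1) by (auto simp: A_def mem_interior)
    qed
    with \<rho>(1) show ?thesis by blast
  qed
  have oB: "open (I - A)"
    unfolding open_dist
  proof
    fix x assume x: "x \<in> I - A"
    then obtain r where r: "r > 0" "\<forall>y\<in>A. norm (y - x) < r \<longrightarrow> x \<in> A"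
      using key by blast
    obtain e where e: "e > 0" "\<And>y. dist y x < e \<Longrightarrow> y \<in> I"
      using oI x unfolding open_dist by blast
    show "\<exists>e>0. \<forall>y. dist y x < e \<longrightarrow> y \<in> I - A"
      using r e x by (intro exI[of _ "min r e"]) (auto simp: dist_norm)
  qed
  let ?C = "connected_component_set I jone"
  have "jone \<in> I" using inv_pair_jone by (auto simp: I_def invertible_iff)
  then have jC: "jone \<in> ?C" by (simp add: connected_component_refl_eq)
  have "ball jone \<epsilon> \<subseteq> {x. f x = \<psi> x}"
    using near(2) by (auto simp: dist_norm norm_minus_commute)
  then have jA: "jone \<in> A"
    using near(1) \<open>jone \<in> I\<close> by (auto simp: A_def mem_interior)
  have "?C \<subseteq> A \<union> (I - A)"
    using connected_component_subset[of I jone] by blast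
  then have "A \<inter> ?C = {} \<or> (I - A) \<inter> ?C = {}"
    using connected_connected_component[of I jone] oA oB by (intro connectedD) auto
  then have "?C \<subseteq> A"
    using jA jC connected_component_subset[of I jone] by blast
  then show ?thesis
    using x agree unfolding I_def by blast
qed

end

section \<open>Existence and uniqueness\<close>

lemma (in unital_complex_jordan_banach_algebra) ball_in_component:
  obtains r where "r > 0" "ball jone r \<subseteq> connected_component_set {a. jinvertible a} jone"
proof -
  obtain r where r: "r > 0" "ball jone r \<subseteq> {a. jinvertible a}"
    using open_invertible inv_pair_jone invertible_iff
    by (metis (no_types, lifting) open_contains_ball mem_Collect_eq)
  then have "ball jone r \<subseteq> connected_component_set {a. jinvertible a} jone"
    by (intro connected_component_maximal) auto
  with r that show ?thesis by blast
qed

theorem theorem3p9: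
  fixes cscale :: "complex \<Rightarrow> 'a::banach \<Rightarrow> 'a"
    and jprod :: "'a \<Rightarrow> 'a \<Rightarrow> 'a"
    and jone :: 'a
    and f :: "'a \<Rightarrow> complex"
  assumes "unital_complex_jordan_banach_algebra cscale jprod jone"
    and "\<And>x y. f (jordan_U cscale jprod x y) = (f x)\<^sup>2 * f y"
    and "\<And>x. f x \<in> jordan_spectrum cscale jprod jone x"
  shows "\<exists>!\<psi> :: 'a \<Rightarrow> complex.
           Vector_Spaces.linear cscale (*) \<psi> \<and>
           continuous_on UNIV \<psi> \<and>
           jordan_multiplicative jprod \<psi> \<and>
           (\<forall>x \<in> connected_component_set {a. jordan_invertible jprod jone a} jone. f x = \<psi> x)"
proof -
  interpret jordan_spectral_functional cscale jprod jone f
    by (intro jordan_spectral_functional.intro[OF assms(1)] jordan_spectral_functional_axioms.intro)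
      (use assms(2,3) in \<open>auto simp: jordan_spectrum_def\<close>)
  obtain \<phi> K where \<phi>: "linear \<phi>" "\<And>a. cmod (\<phi> a) \<le> norm a" "\<And>a. cmod (g a - \<phi> a) \<le> K * (norm a)\<^sup>2"
    "\<And>c. \<phi> (cscale c jone) = c" "\<And>x. jordan_invertible jprod jone x \<Longrightarrow> \<phi> x \<noteq> 0"
    using tangent_functional by blast
  note M = real_linear_multiplicative[OF \<phi>(1,4,5)]
  have add: "\<phi> (a + b) = \<phi> a + \<phi> b" and diff: "\<phi> (a - b) = \<phi> a - \<phi> b" for a b
    using \<phi>(1) by (simp_all add: linear_add linear_diff)
  have one: "\<phi> jone = 1" using \<phi>(4)[of 1] by simp
  have MU: "\<phi> (jordan_U cscale jprod a b) = (\<phi> a)\<^sup>2 * \<phi> b" for a b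
    by (simp add: jordan_U_def diff M power2_eq_square)
  obtain \<epsilon> where \<epsilon>: "\<epsilon> > 0" "\<And>x. norm (x - jone) < \<epsilon> \<Longrightarrow> f x = \<phi> x"
    using agree_near_jone[OF add M(2) one \<phi>(2,3)] by blast
  have vs: "vector_space ((*) :: complex \<Rightarrow> complex \<Rightarrow> complex)"
    by unfold_locales (simp_all add: algebra_simps)
  show ?thesis
  proof (intro ex1I conjI)
    show "Vector_Spaces.linear cscale (*) \<phi>"
      by (rule Vector_Spaces.linear.intro[OF vector_space_axioms vs])
        (simp add: module_hom_def module_hom_axioms_def add M vs vector_space_axioms module_iff_vector_space)
    show "continuous_on UNIV \<phi>"
      using \<phi>(1,2)
      by (intro linear_continuous_on)
        (simp add: bounded_linear_def bounded_linear_axioms_def, metis mult.right_neutral)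
    show "jordan_multiplicative jprod \<phi>"
      by (simp add: jordan_multiplicative_def M)
    show "\<forall>x\<in>connected_component_set {a. jordan_invertible jprod jone a} jone. f x = \<phi> x"
      using agree_on_component[OF M(2) MU one \<epsilon>] by blast
  next
    fix \<psi> :: "'a \<Rightarrow> complex"
    assume \<psi>: "Vector_Spaces.linear cscale (*) \<psi> \<and> continuous_on UNIV \<psi> \<and> jordan_multiplicative jprod \<psi> \<and>
      (\<forall>x\<in>connected_component_set {a. jordan_invertible jprod jone a} jone. f x = \<psi> x)"
    interpret \<psi>: Vector_Spaces.linear cscale "(*)" \<psi> using \<psi> by blast
    obtain r where r: "r > 0" "ball jone r \<subseteq> connected_component_set {a. jordan_invertible jprod jone a} jone"
      using ball_in_component .
    have eq: "\<psi> x = \<phi> x" if "x \<in> ball jone r" for x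
      using \<psi> r(2) that agree_on_component[OF M(2) MU one \<epsilon>] by (metis subsetD)
    show "\<psi> = \<phi>"
    proof
      fix a :: 'a
      \<comment> \<open>Scaling puts \<open>jone + t *\<^sub>R a\<close> into the ball of agreement;
        subtracting the values at \<open>jone\<close> and dividing by \<open>t\<close> gives
        equality at \<open>a\<close>. The added 1 covers \<open>a = 0\<close>.\<close>
      define t where "t = r / (2 * (norm a + 1))"
      have t: "t > 0" using r(1) by (simp add: t_def add_nonneg_pos)
      have "c / (2 * (c + 1)) < 1" if "c \<ge> 0" for c :: real
        using that by (simp add: divide_less_eq)
      then have "r * (norm a / (2 * (norm a + 1))) < r * 1"
        using r(1) by (intro mult_strict_left_mono) (blast intro: norm_ge_zero)+
      then have "norm (t *\<^sub>R a) < r"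
        using t r(1) by (simp add: t_def)
      then have "\<psi> (jone + cscale (of_real t) a) = \<phi> (jone + cscale (of_real t) a)"
        by (intro eq) (simp add: dist_norm scaleR_eq)
      moreover have "\<psi> jone = \<phi> jone"
        using r(1) by (intro eq) simp
      ultimately have "of_real t * \<psi> a = of_real t * \<phi> a"
        by (simp add: \<psi>.add \<psi>.scale add M)
      then show "\<psi> a = \<phi> a" using t by simp
    qed
  qed
qed

end
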